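(* Let $n\ge 1$ and let $\mathrm{NO}_n(z)$ be the $n$th Nekrasov--Okounkov polynomial. Then $\mathrm{NO}_n(z)$ has a unique zero of maximal modulus among its complex zeros. This zero is real, negative, and simple.
   Context: The Nekrasov--Okounkov polynomials are \[ \mathrm{NO}_n(z)=\sum_{\lambda\vdash n}\ \prod_{h\in H(\lambda)}\left(1+\frac{z}{h^2}\right), \] where the sum is over all partitions $\lambda$ of $n$ and $H(\lambda)$ is the multiset of hook lengths of $\lambda$. By the Nekrasov--Okounkov hook-length formula they are equivalently given by the formal power series identity \[ \sum_{n=0}^{\infty}\mathrm{NO}_n(z)q^n=\prod_{m=1}^{\infty}(1-q^m)^{-z-1}. \] Equivalently, $\mathrm{NO}_n(z)=P_n(z+1)$, where $P_0(z)=1$ and $P_n(z)=\frac{z}{n}\sum_{k=1}^n\sigma(k)P_{n-k}(z)$ for $n\ge1$, with $\sigma(k)=\sum_{d\mid k}d$. "Unique zero of maximal modulus" means that there is a zero $\alpha$ such that every zero $\beta\neq\alpha$ satisfies $|\beta|<|\alpha|$; "simple" means multiplicity one. *)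

theory Defs
  imports Complex_Main "HOL-Computational_Algebra.Polynomial" "HOL-Library.Multiset"
begin

definition partitions :: "nat \<Rightarrow> nat list set" where
  "partitions n = {ps. sorted_wrt (\<ge>) ps \<and> 0 \<notin> set ps \<and> sum_list ps = n}"

lemma finite_partitions: "finite (partitions n)"
proof (rule finite_subset)
  show "partitions n \<subseteq> {ps. set ps \<subseteq> {..n} \<and> length ps \<le> n}"
  proof (rule subsetI)
    fix ps assume ps: "ps \<in> partitions n"
    then have sub: "set ps \<subseteq> {..n}"
      using member_le_sum_list by (auto simp: partitions_def)
    have *: "length qs \<le> sum_list qs" if "0 \<notin> set qs" for qs :: "nat list"
      using that by (induction qs) (auto simp: Suc_le_eq)
    from ps * have "length ps \<le> n"
      by (auto simp: partitions_def)
    with sub show "ps \<in> {ps. set ps \<subseteq> {..n} \<and> length ps \<le> n}" by simp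
  qed
  show "finite {ps. set ps \<subseteq> {..n} \<and> length ps \<le> n}"
    by (rule finite_lists_length_le) simp
qed

text \<open>Rows and columns of the Young diagram are numbered from 0.\<close>

definition cells :: "nat list \<Rightarrow> (nat \<times> nat) set" where
  "cells ps = {(i, j). i < length ps \<and> j < ps ! i}"

lemma finite_cells: "finite (cells ps)"
proof -
  have "cells ps = (SIGMA i:{..<length ps}. {..<ps ! i})"
    by (auto simp: cells_def)
  then show ?thesis by simp
qed

definition arm :: "nat list \<Rightarrow> nat \<times> nat \<Rightarrow> nat" where
  "arm ps = (\<lambda>(i, j). card {l. (i, l) \<in> cells ps \<and> j < l})"

definition leg :: "nat list \<Rightarrow> nat \<times> nat \<Rightarrow> nat" where
  "leg ps = (\<lambda>(i, j). card {k. (k, j) \<in> cells ps \<and> i < k})"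

definition hook_length :: "nat list \<Rightarrow> nat \<times> nat \<Rightarrow> nat" where
  "hook_length ps c = arm ps c + leg ps c + 1"

definition hook_lengths :: "nat list \<Rightarrow> nat multiset" where
  "hook_lengths ps = image_mset (hook_length ps) (mset_set (cells ps))"

text \<open>The factor \<open>[:1, 1 / h\<^sup>2:]\<close> is the linear polynomial \<open>1 + z / h\<^sup>2\<close> in \<open>z\<close>.\<close>

definition NO :: "nat \<Rightarrow> complex poly" where
  "NO n = (\<Sum>ps\<in>partitions n. \<Prod>h\<in>#hook_lengths ps. [:1, 1 / of_nat h ^ 2:])"

end

theory Submission
  imports Defs "Jordan_Normal_Form.Determinant" "HOL-Computational_Algebra.Formal_Power_Series"
begin

text \<open>
  The Nekrasov--Okounkov formula is obtained from a trace identity. For \<open>z = - t\<^sup>2\<close> the hook product of a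
  partition is, by the Cauchy determinant, a principal minor of the product of the lower Toeplitz matrix of
  \<open>(1 - s)\<^sup>-\<^sup>t\<close> with the upper Toeplitz matrix of \<open>(1 - s)\<^sup>t\<close>, taken at the first-column hook lengths.
  If \<open>t\<close> is a positive integer, the generating function of these minors is a trace; moving one geometric
  factor of the lower matrix cyclically around it rescales that factor by \<open>q\<close> and produces a scalar, and
  iterating gives \<open>\<Prod>(1 - q\<^sup>m)\<close> to the power \<open>t\<^sup>2 - 1\<close>. Infinitely many \<open>t\<close> determine the polynomials.

  Write \<open>P\<^sub>n(z) = NO\<^sub>n(z - 1)\<close>. Dividing the recurrence of the \<open>P\<^sub>n\<close> by the power series
  \<open>\<Sum>\<sigma>(k + 1) q\<^sup>k\<close> expresses \<open>z P\<^sub>n\<close> linearly in \<open>P\<^sub>1, \<dots>, P\<^sub>n\<^sub>+\<^sub>1\<close>. After the substitution \<open>z = - x\<close> and a change of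
  sign all coefficients are positive, so the zeros are eigenvalues of a nonnegative primitive
  Hessenberg matrix, and a Perron--Frobenius argument yields a simple dominant eigenvalue \<open>\<rho> > 0\<close>.
  Shifting back, \<open>- 1 - \<rho>\<close> still dominates since \<open>\<bar>\<beta>\<bar> \<le> \<bar>\<beta> + 1\<bar> + 1\<close>.
\<close>

section \<open>Minors of infinite matrices\<close>

text \<open>Rows and columns are chosen by arbitrary tuples, not by subsets; a repeated index gives
  minor 0, so expansions of Cauchy-Binet type can run over all tuples.\<close>

definition minor :: "nat \<Rightarrow> (nat \<Rightarrow> nat \<Rightarrow> 'a::comm_ring_1) \<Rightarrow> (nat \<Rightarrow> nat) \<Rightarrow> (nat \<Rightarrow> nat) \<Rightarrow> 'a" where
  "minor n P f g = det (mat n n (\<lambda>(i, j). P (f i) (g j)))"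

lemma minor_Leibniz:
  "minor n P f g = (\<Sum>p | p permutes {..<n}. signof p * (\<Prod>i<n. P (f i) (g (p i))))"
proof -
  have "(\<Prod>i = 0..<n. mat n n (\<lambda>(i, j). P (f i) (g j)) $$ (i, p i)) = (\<Prod>i<n. P (f i) (g (p i)))"
    if "p permutes {..<n}" for p
    unfolding lessThan_atLeast0[symmetric]
    using permutes_in_image[OF that] by (intro prod.cong) (auto simp: lessThan_iff)
  then show ?thesis
    unfolding minor_def by (subst det_def'[of _ n]) (auto simp: lessThan_atLeast0[symmetric] intro!: sum.cong)
qed

lemma minor_cong:
  assumes "\<And>i j. i < n \<Longrightarrow> j < n \<Longrightarrow> P (f i) (g j) = Q (f' i) (g' j)"
  shows "minor n P f g = minor n Q f' g'"
  unfolding minor_def by (intro arg_cong[where f = det] eq_matI) (auto simp: assms)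

lemma minor_transpose: "minor n P f g = minor n (\<lambda>i j. P j i) g f"
proof -
  have "transpose_mat (mat n n (\<lambda>(i, j). P (f i) (g j))) = mat n n (\<lambda>(i, j). P (f j) (g i))"
    by (intro eq_matI) auto
  then show ?thesis
    unfolding minor_def by (metis det_transpose mat_carrier)
qed

text \<open>Multilinearity in the rows, without antisymmetrising over \<open>h\<close>: one factor
  stays a plain product of entries, which can later be moved to the other side of the minor.\<close>

lemma minor_expand_rows:
  assumes "finite K"
    and "\<And>i j. i < n \<Longrightarrow> j < n \<Longrightarrow> Q (f i) (g j) = (\<Sum>k\<in>K. P (f i) k * R k (g j))"
  shows "minor n Q f g = (\<Sum>h\<in>{..<n} \<rightarrow>\<^sub>E K. (\<Prod>i<n. P (f i) (h i)) * minor n R h g)"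
proof -
  have "minor n Q f g = (\<Sum>p | p permutes {..<n}. signof p * (\<Prod>i<n. \<Sum>k\<in>K. P (f i) k * R k (g (p i))))"
    unfolding minor_Leibniz
    by (intro sum.cong arg_cong2[where f = "(*)"] prod.cong refl)
       (auto simp: assms(2) permutes_in_image lessThan_iff dest: permutes_in_image[THEN iffD2])
  also have "\<dots> = (\<Sum>p | p permutes {..<n}. signof p * (\<Sum>h\<in>{..<n} \<rightarrow>\<^sub>E K. \<Prod>i<n. P (f i) (h i) * R (h i) (g (p i))))"
    using assms(1) by (simp add: prod_sum_PiE)
  also have "\<dots> = (\<Sum>h\<in>{..<n} \<rightarrow>\<^sub>E K. (\<Prod>i<n. P (f i) (h i)) * minor n R h g)"
    unfolding minor_Leibniz sum_distrib_left
    by (subst sum.swap) (simp add: prod.distrib mult_ac)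
  finally show ?thesis .
qed

lemma minor_expand_cols:
  assumes "finite K"
    and "\<And>i j. i < n \<Longrightarrow> j < n \<Longrightarrow> Q (f i) (g j) = (\<Sum>k\<in>K. P (f i) k * R k (g j))"
  shows "minor n Q f g = (\<Sum>h\<in>{..<n} \<rightarrow>\<^sub>E K. minor n P f h * (\<Prod>j<n. R (h j) (g j)))"
proof -
  have "minor n (\<lambda>i j. Q j i) g f = (\<Sum>h\<in>{..<n} \<rightarrow>\<^sub>E K. (\<Prod>i<n. R (h i) (g i)) * minor n (\<lambda>i j. P j i) h f)"
    by (intro minor_expand_rows) (simp_all add: assms mult.commute)
  then show ?thesis
    by (subst minor_transpose) (simp add: minor_transpose[of n P] mult.commute)
qed

lemma minor_eq_0_cols:
  assumes "\<not> inj_on g {..<n}"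
  shows "minor n P f g = 0"
proof -
  obtain i j where "i < n" "j < n" "i \<noteq> j" "g i = g j"
    using assms by (auto simp: inj_on_def)
  then show ?thesis
    unfolding minor_def by (intro det_identical_columns[of _ n i j]) (auto intro!: eq_vecI)
qed

text \<open>The sign of \<open>p\<close> enters once through the rows and once through the columns,
  and its square is 1.\<close>

lemma minor_permute:
  assumes p: "p permutes {..<n}"
  shows "minor n P (f \<circ> p) (f \<circ> p) = minor n P f f"
proof -
  have rows: "minor n P (f \<circ> p) g = signof p * minor n P f g" for P :: "nat \<Rightarrow> nat \<Rightarrow> 'a" and g
  proof -
    have "mat n n (\<lambda>(i, j). P ((f \<circ> p) i) (g j)) =
        mat n n (\<lambda>(i, j). mat n n (\<lambda>(i, j). P (f i) (g j)) $$ (p i, j))"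
      using permutes_in_image[OF p] by (intro eq_matI) auto
    then show ?thesis
      unfolding minor_def
      using det_permute_rows[of "mat n n (\<lambda>(i, j). P (f i) (g j))" n p] p by (simp add: lessThan_atLeast0)
  qed
  have "minor n P (f \<circ> p) (f \<circ> p) = signof p * (signof p * minor n P f f)"
    by (simp add: rows minor_transpose[of n P f "f \<circ> p"] minor_transpose[of n P f f])
  then show ?thesis
    by (simp add: sign_def split: if_splits)
qed

section \<open>Toeplitz matrices and their products\<close>

definition lower_Toeplitz :: "'a::comm_ring_1 fps \<Rightarrow> nat \<Rightarrow> nat \<Rightarrow> 'a" where
  "lower_Toeplitz a l m = (if m \<le> l then fps_nth a (l - m) else 0)"

definition upper_Toeplitz :: "(nat \<Rightarrow> 'a::comm_ring_1) \<Rightarrow> nat \<Rightarrow> nat \<Rightarrow> 'a" where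
  "upper_Toeplitz b m l = (if m \<le> l then b (l - m) else 0)"

definition geometric_fps :: "'a::comm_ring_1 \<Rightarrow> 'a fps" where
  "geometric_fps x = Abs_fps (\<lambda>k. x ^ k)"

text \<open>Triangularity confines the inner index to the interval from \<open>m\<close> to
  \<open>l\<close>, so cutting the matrix product off at any \<open>W > l\<close> loses
  nothing.\<close>

lemma lower_Toeplitz_mult:
  assumes "l < W"
  shows "lower_Toeplitz (a * c) l m = (\<Sum>k<W. lower_Toeplitz a l k * lower_Toeplitz c k m)"
proof -
  have "(\<Sum>k<W. lower_Toeplitz a l k * lower_Toeplitz c k m) = (\<Sum>k\<in>{m..l}. fps_nth a (l - k) * fps_nth c (k - m))"
    by (rule sum.mono_neutral_cong_right) (use assms in \<open>auto simp: lower_Toeplitz_def\<close>)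
  also have "\<dots> = lower_Toeplitz (a * c) l m"
  proof (cases "m \<le> l")
    case True
    have "(\<Sum>k\<in>{m..l}. fps_nth a (l - k) * fps_nth c (k - m)) = (\<Sum>i=0..l-m. fps_nth a i * fps_nth c (l - m - i))"
      by (rule sum.reindex_bij_witness[of _ "\<lambda>i. l - i" "\<lambda>k. l - k"]) (use True in auto)
    then show ?thesis using True by (simp add: lower_Toeplitz_def fps_mult_nth)
  qed (auto simp: lower_Toeplitz_def)
  finally show ?thesis by simp
qed

text \<open>The product of the infinite lower and upper matrices; each entry is a finite sum because
  the left factor is lower triangular.\<close>

definition Toeplitz_prod :: "'a::comm_ring_1 fps \<Rightarrow> (nat \<Rightarrow> 'a) \<Rightarrow> nat \<Rightarrow> nat \<Rightarrow> 'a" where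
  "Toeplitz_prod a b i j = (\<Sum>k\<le>i. fps_nth a (i - k) * upper_Toeplitz b k j)"

lemma Toeplitz_prod_eq: "i < W \<Longrightarrow> Toeplitz_prod a b i j = (\<Sum>k<W. lower_Toeplitz a i k * upper_Toeplitz b k j)"
  unfolding Toeplitz_prod_def by (rule sum.mono_neutral_cong_left) (auto simp: lower_Toeplitz_def)

lemma Toeplitz_prod_mult:
  assumes "i < W"
  shows "Toeplitz_prod (a * c) b i j = (\<Sum>k<W. lower_Toeplitz a i k * Toeplitz_prod c b k j)"
proof -
  have "Toeplitz_prod (a * c) b i j = (\<Sum>m<W. (\<Sum>k<W. lower_Toeplitz a i k * lower_Toeplitz c k m) * upper_Toeplitz b m j)"
    using assms by (simp add: Toeplitz_prod_eq lower_Toeplitz_mult)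
  also have "\<dots> = (\<Sum>k<W. lower_Toeplitz a i k * (\<Sum>m<W. lower_Toeplitz c k m * upper_Toeplitz b m j))"
    by (simp add: sum_distrib_left sum_distrib_right mult.assoc) (rule sum.swap)
  also have "\<dots> = (\<Sum>k<W. lower_Toeplitz a i k * Toeplitz_prod c b k j)"
    by (intro sum.cong) (simp_all add: Toeplitz_prod_eq)
  finally show ?thesis .
qed

section \<open>Commuting Toeplitz matrices\<close>

text \<open>The entry of the product in the opposite order, upper times lower. Its sum is finite
  because \<open>b\<close> is cut off at degree \<open>t\<close>.\<close>

definition upper_geometric :: "'a::comm_ring_1 \<Rightarrow> nat \<Rightarrow> (nat \<Rightarrow> 'a) \<Rightarrow> nat \<Rightarrow> nat \<Rightarrow> 'a" where
  "upper_geometric x t b m j = (\<Sum>i\<le>t. b i * lower_Toeplitz (geometric_fps x) (m + i) j)"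

lemma upper_geometric_eq:
  assumes "\<And>k. k > t \<Longrightarrow> b k = 0" "m + t < W"
  shows "(\<Sum>k<W. upper_Toeplitz b m k * lower_Toeplitz (geometric_fps x) k j) = upper_geometric x t b m j"
proof -
  have "(\<Sum>k<W. upper_Toeplitz b m k * lower_Toeplitz (geometric_fps x) k j) = (\<Sum>k\<in>{m..m+t}. upper_Toeplitz b m k * lower_Toeplitz (geometric_fps x) k j)"
    by (rule sum.mono_neutral_right) (use assms in \<open>auto simp: upper_Toeplitz_def\<close>)
  also have "\<dots> = upper_geometric x t b m j"
    unfolding upper_geometric_def
    by (rule sum.reindex_bij_witness[of _ "\<lambda>i. m + i" "\<lambda>k. k - m"]) (auto simp: upper_Toeplitz_def)
  finally show ?thesis .
qed

lemma lower_Toeplitz_geometric_Suc: "lower_Toeplitz (geometric_fps x) (Suc l) j = x * lower_Toeplitz (geometric_fps x) l j + (if j = Suc l then 1 else 0)"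
  by (auto simp: lower_Toeplitz_def geometric_fps_def Suc_diff_le not_le)

text \<open>With \<open>A\<close> the lower Toeplitz matrix of the geometric series and \<open>B\<close> the upper Toeplitz matrix
  of \<open>b\<close>, one has \<open>B A = A Y\<close> where \<open>Y\<close> agrees with \<open>B\<close> outside row 0. The column 0 of \<open>Y\<close> is
  \<open>b(x)\<close> times that of \<open>B\<close>, so minors whose column set contains 0 acquire exactly the factor \<open>b(x)\<close>.\<close>

definition upper_Toeplitz_row0 :: "'a::comm_ring_1 \<Rightarrow> nat \<Rightarrow> (nat \<Rightarrow> 'a) \<Rightarrow> nat \<Rightarrow> nat \<Rightarrow> 'a" where
  "upper_Toeplitz_row0 x t b k j = (if k = 0 then upper_geometric x t b 0 j else upper_Toeplitz b k j)"

text \<open>By induction on the row: each row of the geometric matrix is \<open>x\<close> times the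
  preceding one plus a unit vector, so row \<open>Suc m\<close> of the product is \<open>x\<close>
  times row \<open>m\<close> plus row \<open>Suc m\<close> of the Toeplitz matrix of
  \<open>b\<close>.\<close>

lemma upper_geometric_factor:
  assumes "\<And>k. k > t \<Longrightarrow> b k = 0"
  shows "upper_geometric x t b m j = (\<Sum>k\<le>m. x ^ (m - k) * upper_Toeplitz_row0 x t b k j)"
proof (induction m)
  case 0
  then show ?case by (simp add: upper_Toeplitz_row0_def)
next
  case (Suc m)
  have "upper_geometric x t b (Suc m) j = (\<Sum>i\<le>t. b i * (x * lower_Toeplitz (geometric_fps x) (m + i) j + (if j = Suc (m + i) then 1 else 0)))"
    unfolding upper_geometric_def by (simp add: lower_Toeplitz_geometric_Suc)
  also have "\<dots> = x * upper_geometric x t b m j + (\<Sum>i\<le>t. b i * (if j = Suc (m + i) then 1 else 0))"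
    by (simp add: upper_geometric_def sum_distrib_left sum.distrib algebra_simps)
  also have "(\<Sum>i\<le>t. b i * (if j = Suc (m + i) then 1 else 0)) = upper_Toeplitz b (Suc m) j"
  proof (cases "Suc m \<le> j")
    case True
    have "(\<Sum>i\<le>t. b i * (if j = Suc (m + i) then 1 else 0)) = (\<Sum>i\<le>t. if i = j - Suc m then b i else 0)"
      using True by (intro sum.cong) auto
    then show ?thesis using True assms[of "j - Suc m"] by (auto simp: upper_Toeplitz_def)
  qed (auto simp: upper_Toeplitz_def intro!: sum.neutral)
  finally show ?case
    using Suc by (simp add: upper_Toeplitz_row0_def sum_distrib_left Suc_diff_le mult.assoc)
qed

text \<open>Left multiplication by the lower matrix \<open>R\<close> of \<open>r\<close> turns
  \<open>B A = A Y\<close> into \<open>(R B) A = (R A) Y\<close>. Row \<open>i\<close> of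
  \<open>R B\<close> vanishes beyond column \<open>i + t\<close>, hence the condition on
  \<open>W\<close>.\<close>

lemma Toeplitz_prod_geometric_commute:
  assumes "\<And>k. k > t \<Longrightarrow> b k = 0" "i + t < W"
  shows "(\<Sum>k<W. Toeplitz_prod r b i k * lower_Toeplitz (geometric_fps x) k j) = (\<Sum>k<W. lower_Toeplitz (r * geometric_fps x) i k * upper_Toeplitz_row0 x t b k j)"
proof -
  have "(\<Sum>k<W. Toeplitz_prod r b i k * lower_Toeplitz (geometric_fps x) k j) = (\<Sum>m\<le>i. fps_nth r (i - m) * (\<Sum>k<W. upper_Toeplitz b m k * lower_Toeplitz (geometric_fps x) k j))"
    unfolding Toeplitz_prod_def by (simp add: sum_distrib_left sum_distrib_right mult.assoc) (rule sum.swap)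
  also have "\<dots> = (\<Sum>m\<le>i. fps_nth r (i - m) * (\<Sum>k\<le>m. x ^ (m - k) * upper_Toeplitz_row0 x t b k j))"
    using assms(2) by (intro sum.cong refl) (simp add: upper_geometric_eq[OF assms(1)] upper_geometric_factor[OF assms(1)])
  also have "\<dots> = (\<Sum>m<W. lower_Toeplitz r i m * (\<Sum>k<W. lower_Toeplitz (geometric_fps x) m k * upper_Toeplitz_row0 x t b k j))"
  proof (rule sum.mono_neutral_cong_left)
    fix m assume "m \<in> {..i}"
    then have "(\<Sum>k\<le>m. x ^ (m - k) * upper_Toeplitz_row0 x t b k j) = (\<Sum>k<W. lower_Toeplitz (geometric_fps x) m k * upper_Toeplitz_row0 x t b k j)"
      using assms(2) by (intro sum.mono_neutral_cong_left) (auto simp: lower_Toeplitz_def geometric_fps_def)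
    then show "fps_nth r (i - m) * (\<Sum>k\<le>m. x ^ (m - k) * upper_Toeplitz_row0 x t b k j) =
      lower_Toeplitz r i m * (\<Sum>k<W. lower_Toeplitz (geometric_fps x) m k * upper_Toeplitz_row0 x t b k j)"
      using \<open>m \<in> {..i}\<close> by (simp add: lower_Toeplitz_def)
  qed (use assms(2) in \<open>auto simp: lower_Toeplitz_def\<close>)
  also have "\<dots> = (\<Sum>k<W. (\<Sum>m<W. lower_Toeplitz r i m * lower_Toeplitz (geometric_fps x) m k) * upper_Toeplitz_row0 x t b k j)"
    by (simp add: sum_distrib_left sum_distrib_right mult.assoc) (rule sum.swap)
  also have "\<dots> = (\<Sum>k<W. lower_Toeplitz (r * geometric_fps x) i k * upper_Toeplitz_row0 x t b k j)"
    using assms(2) by (simp add: lower_Toeplitz_mult[of i W])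
  finally show ?thesis .
qed

text \<open>Expand along columns. Column 0 of both \<open>upper_Toeplitz_row0\<close> and
  \<open>upper_Toeplitz\<close> is supported in row 0, so \<open>h i0 = 0\<close> in every nonzero
  term. Injectivity of \<open>h\<close> keeps the other indices off row 0, and outside that row the
  two matrices agree.\<close>

lemma minor_upper_Toeplitz_row0:
  assumes b0: "b 0 = 1" and i0: "i0 < n" "f i0 = 0" and W: "\<And>i. i < n \<Longrightarrow> g i < W"
  shows "minor n (\<lambda>i j. \<Sum>k<W. lower_Toeplitz a i k * upper_Toeplitz_row0 x t b k j) g f = (\<Sum>i\<le>t. b i * x ^ i) * minor n (Toeplitz_prod a b) g f"
proof -
  have diag: "upper_Toeplitz_row0 x t b k 0 = (if k = 0 then \<Sum>i\<le>t. b i * x ^ i else 0)" for k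
    by (simp add: upper_Toeplitz_row0_def upper_geometric_def lower_Toeplitz_def geometric_fps_def upper_Toeplitz_def)
  have "minor n (lower_Toeplitz a) g h * (\<Prod>j<n. upper_Toeplitz_row0 x t b (h j) (f j)) =
      (\<Sum>i\<le>t. b i * x ^ i) * (minor n (lower_Toeplitz a) g h * (\<Prod>j<n. upper_Toeplitz b (h j) (f j)))"
    if "h \<in> {..<n} \<rightarrow>\<^sub>E {..<W}" for h
  proof (cases "inj_on h {..<n} \<and> h i0 = 0")
    case True
    have "0 < h j" if "j < n" "j \<noteq> i0" for j
      using True that i0 by (metis gr0I inj_on_eq_iff lessThan_iff)
    then have "(\<Prod>j\<in>{..<n} - {i0}. upper_Toeplitz_row0 x t b (h j) (f j)) = (\<Prod>j\<in>{..<n} - {i0}. upper_Toeplitz b (h j) (f j))"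
      by (intro prod.cong refl) (fastforce simp: upper_Toeplitz_row0_def)
    then show ?thesis
      using True i0 b0 by (simp add: prod.remove[of "{..<n}" i0] diag upper_Toeplitz_def)
  next
    case False
    then consider "\<not> inj_on h {..<n}" | "h i0 \<noteq> 0" by auto
    then show ?thesis
    proof cases
      case 1
      then show ?thesis by (simp add: minor_eq_0_cols)
    next
      case 2
      have "(\<Prod>j<n. upper_Toeplitz_row0 x t b (h j) (f j)) = 0" "(\<Prod>j<n. upper_Toeplitz b (h j) (f j)) = 0"
        using 2 i0 diag[of "h i0"] by (auto intro!: prod_zero bexI[of _ i0] simp: upper_Toeplitz_def)
      then show ?thesis by simp
    qed
  qed
  then show ?thesis
    by (subst (1 2) minor_expand_cols[of "{..<W}", where P = "lower_Toeplitz a"])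
       (auto simp: Toeplitz_prod_eq W sum_distrib_left intro!: sum.cong)
qed

text \<open>Used contrapositively: an injective tuple whose sum lies below
  \<open>1 + ... + card A\<close> takes the value 0, which supplies the column 0 behind the scalar
  factor. The induction removes the maximum, which is at least the cardinality.\<close>

lemma sum_inj_ge:
  fixes f :: "nat \<Rightarrow> nat"
  assumes "finite A" "0 \<notin> f ` A" "inj_on f A"
  shows "card A * (card A - 1) div 2 + card A \<le> sum f A"
proof -
  have "\<Sum>{1..card B} \<le> \<Sum>B" if "finite B" "0 \<notin> B" for B :: "nat set"
    using that
  proof (induction "card B" arbitrary: B)
    case (Suc k)
    have ne: "B \<noteq> {}" using Suc.hyps(2) by auto
    have "B \<subseteq> {1..Max B}" using Suc.prems by (auto simp: Suc_le_eq intro: gr0I)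
    then have "Suc k \<le> Max B" using card_mono[of "{1..Max B}" B] Suc.hyps(2) by simp
    moreover have "k = card (B - {Max B})"
      using Suc.hyps(2) Suc.prems ne by simp
    then have "\<Sum>{1..k} \<le> \<Sum>(B - {Max B})"
      using Suc.hyps(1)[of "B - {Max B}"] Suc.prems by simp
    moreover have "\<Sum>B = Max B + \<Sum>(B - {Max B})"
      using Suc.prems ne by (simp add: sum.remove[of B "Max B"])
    ultimately show ?case by (simp flip: Suc.hyps(2))
  qed auto
  from this[of "f ` A"] have "\<Sum>{1..card A} \<le> sum f A"
    using assms by (simp add: card_image sum.reindex)
  moreover have "\<Sum>{1..k} = k * (k - 1) div 2 + k" for k :: nat
  proof -
    have "k * (k + 1) = k * (k - 1) + k * 2" by (cases k) auto
    then show ?thesis by (simp add: Sum_Icc_nat)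
  qed
  ultimately show ?thesis by simp
qed

section \<open>The trace identity\<close>

text \<open>Summing over tuples instead of subsets counts every \<open>n\<close>-element subset \<open>n!\<close> times. The bound \<open>W\<close>
  truncates the matrices and is harmless modulo \<open>q ^ D\<close>.\<close>

definition weighted_trace :: "nat \<Rightarrow> nat \<Rightarrow> 'a::comm_ring_1 \<Rightarrow> 'a fps \<Rightarrow> (nat \<Rightarrow> 'a) \<Rightarrow> 'a" where
  "weighted_trace n W q a b = (\<Sum>f\<in>{..<n} \<rightarrow>\<^sub>E {..<W}. q ^ (\<Sum>i<n. f i) * minor n (Toeplitz_prod a b) f f)"

text \<open>Cyclicity of the trace: the geometric factor is expanded off the rows and reabsorbed
  into the columns. Passing the weight across it uses
  \<open>q ^ l * x ^ (l - m) = q ^ m * (q * x) ^ (l - m)\<close>, which replaces \<open>x\<close> by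
  \<open>q * x\<close>.\<close>

lemma weighted_trace_cyclic:
  "weighted_trace n W q (geometric_fps x * r) b =
    (\<Sum>h\<in>{..<n} \<rightarrow>\<^sub>E {..<W}. q ^ (\<Sum>i<n. h i) *
       minor n (\<lambda>i j. \<Sum>k<W. Toeplitz_prod r b i k * lower_Toeplitz (geometric_fps (q * x)) k j) h h)"
proof -
  have weight: "q ^ (\<Sum>i<n. f i) * (\<Prod>i<n. lower_Toeplitz (geometric_fps x) (f i) (h i)) =
      q ^ (\<Sum>i<n. h i) * (\<Prod>i<n. lower_Toeplitz (geometric_fps (q * x)) (f i) (h i))" for f h :: "nat \<Rightarrow> nat"
  proof -
    have "q ^ l * lower_Toeplitz (geometric_fps x) l m = q ^ m * lower_Toeplitz (geometric_fps (q * x)) l m" for l m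
      by (auto simp: lower_Toeplitz_def geometric_fps_def power_mult_distrib le_iff_add power_add)
    then show ?thesis by (simp add: power_sum flip: prod.distrib)
  qed
  have "weighted_trace n W q (geometric_fps x * r) b = (\<Sum>f\<in>{..<n} \<rightarrow>\<^sub>E {..<W}. q ^ (\<Sum>i<n. f i) *
      (\<Sum>h\<in>{..<n} \<rightarrow>\<^sub>E {..<W}. (\<Prod>i<n. lower_Toeplitz (geometric_fps x) (f i) (h i)) * minor n (Toeplitz_prod r b) h f))"
    unfolding weighted_trace_def
    by (intro sum.cong refl arg_cong2[where f = "(*)"] minor_expand_rows) (auto intro!: Toeplitz_prod_mult)
  also have "\<dots> = (\<Sum>h\<in>{..<n} \<rightarrow>\<^sub>E {..<W}. q ^ (\<Sum>i<n. h i) *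
      (\<Sum>f\<in>{..<n} \<rightarrow>\<^sub>E {..<W}. minor n (Toeplitz_prod r b) h f * (\<Prod>i<n. lower_Toeplitz (geometric_fps (q * x)) (f i) (h i))))"
  proof -
    have "q ^ (\<Sum>i<n. f i) * ((\<Prod>i<n. lower_Toeplitz (geometric_fps x) (f i) (h i)) * m) =
        q ^ (\<Sum>i<n. h i) * (m * (\<Prod>i<n. lower_Toeplitz (geometric_fps (q * x)) (f i) (h i)))" for f h :: "nat \<Rightarrow> nat" and m
      using arg_cong[OF weight[of f h], of "\<lambda>u. u * m"] by (simp only: mult_ac)
    then show ?thesis
      unfolding sum_distrib_left by (subst sum.swap) simp
  qed
  also have "\<dots> = (\<Sum>h\<in>{..<n} \<rightarrow>\<^sub>E {..<W}. q ^ (\<Sum>i<n. h i) *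
       minor n (\<lambda>i j. \<Sum>k<W. Toeplitz_prod r b i k * lower_Toeplitz (geometric_fps (q * x)) k j) h h)"
    by (intro sum.cong refl arg_cong2[where f = "(*)"] minor_expand_cols[symmetric]) auto
  finally show ?thesis .
qed

text \<open>Compared tuple by tuple. If the entries sum to at least \<open>D\<close>, both terms
  vanish modulo \<open>q ^ D\<close>. Otherwise every entry is below \<open>D\<close>, so the
  truncation at \<open>W\<close> is exact, and an injective tuple contains 0, so its minor gains the
  scalar factor.\<close>

lemma weighted_trace_step:
  assumes b: "b 0 = 1" "\<And>k. k > t \<Longrightarrow> b k = 0"
    and D: "D + t \<le> W" "D \<le> n * (n - 1) div 2 + n"
  shows "q ^ D dvd weighted_trace n W q (geometric_fps x * r) b - (\<Sum>i\<le>t. b i * (q * x) ^ i) * weighted_trace n W q (geometric_fps (q * x) * r) b"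
proof -
  let ?\<beta> = "\<Sum>i\<le>t. b i * (q * x) ^ i"
  let ?M = "\<lambda>h. minor n (\<lambda>i j. \<Sum>k<W. Toeplitz_prod r b i k * lower_Toeplitz (geometric_fps (q * x)) k j) h h"
  have "q ^ D dvd q ^ (\<Sum>i<n. h i) * ?M h - ?\<beta> * (q ^ (\<Sum>i<n. h i) * minor n (Toeplitz_prod (geometric_fps (q * x) * r) b) h h)"
    if h: "h \<in> {..<n} \<rightarrow>\<^sub>E {..<W}" for h
  proof (cases "D \<le> (\<Sum>i<n. h i)")
    case True
    then show ?thesis
      by (intro dvd_diff dvd_mult dvd_mult2 le_imp_power_dvd)
  next
    case False
    have hD: "h i < D" if "i < n" for i
      using member_le_sum[of i "{..<n}" h] that False by simp
    have M: "?M h = minor n (\<lambda>i j. \<Sum>k<W. lower_Toeplitz (r * geometric_fps (q * x)) i k * upper_Toeplitz_row0 (q * x) t b k j) h h"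
    proof (rule minor_cong)
      fix i j assume "i < n" "j < n"
      then have "h i + t < W" using hD[of i] D(1) by simp
      then show "(\<Sum>k<W. Toeplitz_prod r b (h i) k * lower_Toeplitz (geometric_fps (q * x)) k (h j)) =
          (\<Sum>k<W. lower_Toeplitz (r * geometric_fps (q * x)) (h i) k * upper_Toeplitz_row0 (q * x) t b k (h j))"
        by (intro Toeplitz_prod_geometric_commute b)
    qed
    show ?thesis
    proof (cases "inj_on h {..<n}")
      case True
      then obtain i0 where "i0 < n" "h i0 = 0"
        using sum_inj_ge[of "{..<n}" h] D(2) False by fastforce
      then have "?M h = ?\<beta> * minor n (Toeplitz_prod (geometric_fps (q * x) * r) b) h h"
        using h unfolding M by (subst minor_upper_Toeplitz_row0) (auto simp: b mult.commute)
      then show ?thesis by (simp add: algebra_simps)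
    next
      case False
      then show ?thesis by (simp add: minor_eq_0_cols)
    qed
  qed
  then show ?thesis
    unfolding weighted_trace_cyclic[of n W q x r b] weighted_trace_def[of n W q "geometric_fps (q * x) * r" b] sum_distrib_left
    by (simp add: dvd_sum flip: sum_subtractf)
qed

section \<open>Congruences and iteration of the cyclic step\<close>

lemma dvd_diff_trans:
  fixes d :: "'a::comm_ring_1"
  assumes "d dvd a - b" "d dvd b - c"
  shows "d dvd a - c"
  using dvd_add[OF assms] by simp

lemma dvd_diff_mult:
  fixes d :: "'a::comm_ring_1"
  assumes "d dvd a - b" "d dvd u - v"
  shows "d dvd a * u - b * v"
proof -
  have "a * u - b * v = (a - b) * u + b * (u - v)" by (simp add: algebra_simps)
  then show ?thesis using assms by simp
qed

lemma dvd_diff_prod: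
  fixes d :: "'a::comm_ring_1"
  assumes "\<And>i. i \<in> A \<Longrightarrow> d dvd f i - g i"
  shows "d dvd prod f A - prod g A"
  using assms by (induction A rule: infinite_finite_induct) (auto intro: dvd_diff_mult)

lemma dvd_diff_minor:
  assumes "\<And>i j. i < n \<Longrightarrow> j < n \<Longrightarrow> d dvd P (f i) (g j) - Q (f i) (g j)"
  shows "d dvd minor n P f g - minor n Q f g"
  unfolding minor_Leibniz sum_subtractf[symmetric] right_diff_distrib[symmetric]
  by (intro dvd_sum dvd_mult dvd_diff_prod assms) (auto dest: permutes_in_image)

definition sgn_choose :: "nat \<Rightarrow> nat \<Rightarrow> 'a::comm_ring_1" where
  "sgn_choose t k = (- 1) ^ k * of_nat (t choose k)"

lemma sgn_choose_0 [simp]: "sgn_choose t 0 = 1"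
  by (simp add: sgn_choose_def)

lemma sgn_choose_eq_0: "k > t \<Longrightarrow> sgn_choose t k = 0"
  by (simp add: sgn_choose_def binomial_eq_0)

lemma sgn_choose_sum: "(\<Sum>i\<le>t. sgn_choose t i * x ^ i) = (1 - x) ^ t" for x :: "'a::comm_ring_1"
proof -
  have "(- x + 1) ^ t = (\<Sum>i\<le>t. of_nat (t choose i) * (- x) ^ i * 1 ^ (t - i))"
    by (rule binomial_ring)
  also have "\<dots> = (\<Sum>i\<le>t. sgn_choose t i * x ^ i)"
    by (intro sum.cong refl) (subst power_minus, simp add: sgn_choose_def mult_ac)
  finally show ?thesis by simp
qed

text \<open>The \<open>s\<close> geometric factors are rescaled one at a time; \<open>r\<close> is
  arbitrary in the induction so that it can absorb the factors already rescaled.\<close>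

lemma weighted_trace_geometric_power:
  assumes D: "D + t \<le> W" "D \<le> n * (n - 1) div 2 + n"
  shows "q ^ D dvd weighted_trace n W q (geometric_fps x ^ s * r) (sgn_choose t) -
           (1 - q * x) ^ (t * s) * weighted_trace n W q (geometric_fps (q * x) ^ s * r) (sgn_choose t)"
proof (induction s arbitrary: r)
  case (Suc s)
  let ?T = "\<lambda>a. weighted_trace n W q a (sgn_choose t)" and ?\<beta> = "(1 - q * x) ^ t"
  have 1: "q ^ D dvd ?T (geometric_fps x * (geometric_fps x ^ s * r)) - ?\<beta> * ?T (geometric_fps (q * x) * (geometric_fps x ^ s * r))"
    by (subst sgn_choose_sum[symmetric], rule weighted_trace_step[OF _ _ D]) (auto simp: sgn_choose_eq_0)
  have 2: "q ^ D dvd ?\<beta> * ?T (geometric_fps x ^ s * (geometric_fps (q * x) * r)) -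
      ?\<beta> * ((1 - q * x) ^ (t * s) * ?T (geometric_fps (q * x) ^ s * (geometric_fps (q * x) * r)))"
    using Suc.IH by (intro dvd_diff_mult) auto
  have eqs: "geometric_fps x ^ s * (geometric_fps (q * x) * r) = geometric_fps (q * x) * (geometric_fps x ^ s * r)"
    "geometric_fps (q * x) ^ s * (geometric_fps (q * x) * r) = geometric_fps (q * x) ^ Suc s * r"
    "geometric_fps x * (geometric_fps x ^ s * r) = geometric_fps x ^ Suc s * r"
    by (simp_all only: power_Suc mult_ac)
  have "?\<beta> * (1 - q * x) ^ (t * s) = (1 - q * x) ^ (t * Suc s)"
    by (simp add: power_add)
  then show ?case
    using dvd_diff_trans[OF 1 2[unfolded eqs(1,2)], unfolded eqs(3)] by (simp only: mult.assoc[symmetric])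
qed simp

text \<open>Round \<open>Suc J\<close> rescales all \<open>t\<close> geometric factors from ratio
  \<open>q ^ J\<close> to \<open>q ^ Suc J\<close>, and each contributes
  \<open>(1 - q ^ Suc J) ^ t\<close>; this is the source of the exponent
  \<open>t * t\<close>.\<close>

lemma weighted_trace_iterate:
  assumes D: "D + t \<le> W" "D \<le> n * (n - 1) div 2 + n"
  shows "q ^ D dvd weighted_trace n W q (geometric_fps 1 ^ t) (sgn_choose t) -
           (\<Prod>m=1..J. 1 - q ^ m) ^ (t * t) * weighted_trace n W q (geometric_fps (q ^ J) ^ t) (sgn_choose t)"
proof (induction J)
  case (Suc J)
  let ?T = "\<lambda>a. weighted_trace n W q a (sgn_choose t)"
  have "q ^ D dvd (\<Prod>m=1..J. 1 - q ^ m) ^ (t * t) * ?T (geometric_fps (q ^ J) ^ t) -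
      (\<Prod>m=1..J. 1 - q ^ m) ^ (t * t) * ((1 - q * q ^ J) ^ (t * t) * ?T (geometric_fps (q * q ^ J) ^ t))"
    using weighted_trace_geometric_power[OF D, of q "q ^ J" t 1] by (intro dvd_diff_mult) simp_all
  note dvd_diff_trans[OF Suc.IH this]
  moreover have "(\<Prod>m=1..Suc J. 1 - q ^ m) ^ (t * t) = (\<Prod>m=1..J. 1 - q ^ m) ^ (t * t) * (1 - q * q ^ J) ^ (t * t)"
    by (simp add: power_mult_distrib)
  ultimately show ?case
    by (simp only: mult.assoc power_Suc)
qed simp

text \<open>Only the identity permutation contributes. If \<open>f i \<le> f (p i)\<close> for all
  \<open>i\<close>, equality of the two sums forces equality termwise, and injectivity makes
  \<open>p\<close> the identity; any other \<open>p\<close> hits an entry below the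
  diagonal.\<close>

lemma minor_upper_Toeplitz_diag:
  assumes "b 0 = 1" "inj_on f {..<n}"
  shows "minor n (upper_Toeplitz b) f f = 1"
proof -
  have "signof p * (\<Prod>i<n. upper_Toeplitz b (f i) (f (p i))) = 0" if p: "p permutes {..<n}" and "p \<noteq> id" for p
  proof -
    have "\<exists>i<n. f (p i) < f i"
    proof (rule ccontr)
      assume "\<not> ?thesis"
      then have le: "f i \<le> f (p i)" if "i \<in> {..<n}" for i using that by (meson lessThan_iff not_less)
      have eq: "(\<Sum>i<n. f i) = (\<Sum>i<n. f (p i))"
        using sum.permute[OF p, of f] by simp
      have "f i = f (p i)" if "i < n" for i
        by (rule sum_mono_inv[OF eq le]) (use that in auto)
      then have "p i = i" if "i < n" for i
        using that assms(2) permutes_in_image[OF p] by (auto simp: inj_on_eq_iff)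
      moreover have "p i = i" if "\<not> i < n" for i using p that by (simp add: permutes_def)
      ultimately show False using \<open>p \<noteq> id\<close> by (metis eq_id_iff)
    qed
    then have "(\<Prod>i<n. upper_Toeplitz b (f i) (f (p i))) = 0"
      by (intro prod_zero) (auto simp: upper_Toeplitz_def intro!: bexI)
    then show ?thesis by simp
  qed
  then have "minor n (upper_Toeplitz b) f f = (\<Sum>p\<in>{id}. signof p * (\<Prod>i<n. upper_Toeplitz b (f i) (f (p i))))"
    unfolding minor_Leibniz by (intro sum.mono_neutral_right) (auto simp: permutes_id finite_permutations)
  then show ?thesis using assms(1) by (simp add: upper_Toeplitz_def)
qed

lemma weighted_trace_one:
  assumes "b 0 = 1"
  shows "weighted_trace n W q 1 b = (\<Sum>f | f \<in> {..<n} \<rightarrow>\<^sub>E {..<W} \<and> inj_on f {..<n}. q ^ (\<Sum>i<n. f i))"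
proof -
  have "Toeplitz_prod 1 b = upper_Toeplitz b"
  proof (intro ext)
    fix i j
    have "Toeplitz_prod 1 b i j = (\<Sum>k\<le>i. if k = i then upper_Toeplitz b k j else 0)"
      unfolding Toeplitz_prod_def by (intro sum.cong) auto
    then show "Toeplitz_prod 1 b i j = upper_Toeplitz b i j" by simp
  qed
  then have "weighted_trace n W q 1 b = (\<Sum>f\<in>{..<n} \<rightarrow>\<^sub>E {..<W}. if inj_on f {..<n} then q ^ (\<Sum>i<n. f i) else 0)"
    unfolding weighted_trace_def by (intro sum.cong) (auto simp: minor_upper_Toeplitz_diag assms minor_eq_0_cols)
  also have "\<dots> = (\<Sum>f | f \<in> {..<n} \<rightarrow>\<^sub>E {..<W} \<and> inj_on f {..<n}. q ^ (\<Sum>i<n. f i))"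
    by (rule sum.mono_neutral_cong_right) (auto simp: finite_PiE)
  finally show ?thesis .
qed

lemma geometric_fps_power_dvd: "x dvd fps_nth (geometric_fps x ^ t) k - fps_nth 1 k"
proof (induction t arbitrary: k)
  case (Suc t)
  have eq: "fps_nth (geometric_fps x ^ Suc t) k - fps_nth 1 k = (fps_nth (geometric_fps x ^ t) k - fps_nth 1 k) +
     (\<Sum>i = 1..k. x ^ i * fps_nth (geometric_fps x ^ t) (k - i))"
    by (simp add: fps_mult_nth geometric_fps_def sum.atLeast_Suc_atMost[of 0 k])
  have "x dvd (\<Sum>i = 1..k. x ^ i * fps_nth (geometric_fps x ^ t) (k - i))"
    by (intro dvd_sum dvd_mult2) (auto simp: dvd_power)
  then show ?case
    unfolding eq by (intro dvd_add Suc)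
qed auto

text \<open>After \<open>D\<close> rounds the ratio \<open>q ^ D\<close> is 0 modulo
  \<open>q ^ D\<close>, so the lower factor becomes the identity, and the principal minors of the
  upper factor alone are 1 on injective tuples.\<close>

lemma weighted_trace_eq:
  assumes D: "D + t \<le> W" "D \<le> n * (n - 1) div 2 + n"
  shows "q ^ D dvd weighted_trace n W q (geometric_fps 1 ^ t) (sgn_choose t) -
           (\<Prod>m=1..D. 1 - q ^ m) ^ (t * t) * (\<Sum>f | f \<in> {..<n} \<rightarrow>\<^sub>E {..<W} \<and> inj_on f {..<n}. q ^ (\<Sum>i<n. f i))"
proof -
  have "q ^ D dvd Toeplitz_prod (geometric_fps (q ^ D) ^ t) (sgn_choose t) i j - Toeplitz_prod 1 (sgn_choose t) i j" for i j
    unfolding Toeplitz_prod_def sum_subtractf[symmetric] by (intro dvd_sum dvd_diff_mult geometric_fps_power_dvd) auto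
  then have "q ^ D dvd weighted_trace n W q (geometric_fps (q ^ D) ^ t) (sgn_choose t) - weighted_trace n W q 1 (sgn_choose t)"
    unfolding weighted_trace_def sum_subtractf[symmetric] by (intro dvd_sum dvd_diff_mult dvd_diff_minor) auto
  then have "q ^ D dvd (\<Prod>m=1..D. 1 - q ^ m) ^ (t * t) * weighted_trace n W q (geometric_fps (q ^ D) ^ t) (sgn_choose t)
     - (\<Prod>m=1..D. 1 - q ^ m) ^ (t * t) * weighted_trace n W q 1 (sgn_choose t)"
    by (intro dvd_diff_mult) auto
  from dvd_diff_trans[OF weighted_trace_iterate[OF D] this] show ?thesis
    by (simp add: weighted_trace_one sgn_choose_def)
qed

section \<open>Cauchy determinants\<close>

lemma minor_scale:
  "minor n (\<lambda>i j. r i * P i j * c j) f g = (\<Prod>i<n. r (f i)) * (\<Prod>j<n. c (g j)) * minor n P f g"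
proof -
  have "(\<Prod>i<n. c (g (p i))) = (\<Prod>j<n. c (g j))" if "p permutes {..<n}" for p
    using prod.permute[OF that, of "\<lambda>j. c (g j)"] by simp
  then show ?thesis
    unfolding minor_Leibniz sum_distrib_left
    by (intro sum.cong refl) (simp add: prod.distrib mult_ac)
qed

text \<open>Elimination of the last column: the matrix is a unit upper triangular one times a block
  lower triangular one, whose diagonal blocks are the Schur complement and the pivot.\<close>

lemma minor_Schur:
  fixes P :: "nat \<Rightarrow> nat \<Rightarrow> 'a::field"
  assumes d: "P (f n) (g n) \<noteq> 0"
  shows "minor (Suc n) P f g = P (f n) (g n) *
    minor n (\<lambda>i j. P (f i) (g j) - P (f i) (g n) * P (f n) (g j) / P (f n) (g n)) id id"
proof -
  let ?d = "P (f n) (g n)"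
  let ?M = "mat (Suc n) (Suc n) (\<lambda>(i, j). P (f i) (g j))"
  define A where "A = mat (Suc n) (Suc n) (\<lambda>(i, j). if i = j then 1 else if j = n then P (f i) (g n) / ?d else 0)"
  define B1 where "B1 = mat n n (\<lambda>(i, j). P (f i) (g j) - P (f i) (g n) * P (f n) (g j) / ?d)"
  define B3 where "B3 = mat 1 n (\<lambda>(i, j). P (f n) (g j))"
  define B4 where "B4 = mat 1 1 (\<lambda>(i, j). ?d)"
  define B where "B = four_block_mat B1 (0\<^sub>m n 1) B3 B4"
  have dims: "A \<in> carrier_mat (Suc n) (Suc n)" "B \<in> carrier_mat (Suc n) (Suc n)"
    unfolding A_def B_def B1_def B4_def by (auto simp: four_block_mat_def Let_def)
  have Bij: "B $$ (i, j) = (if i < n then if j < n then P (f i) (g j) - P (f i) (g n) * P (f n) (g j) / ?d else 0 else P (f n) (g j))"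
    if "i < Suc n" "j < Suc n" for i j
    using that by (cases "j = n") (auto simp: B_def B1_def B3_def B4_def less_Suc_eq)
  have "?M = A * B"
  proof (rule eq_matI)
    fix i j assume "i < dim_row (A * B)" "j < dim_col (A * B)"
    then have ij: "i < Suc n" "j < Suc n" using dims by auto
    then have "(A * B) $$ (i, j) = (\<Sum>k<Suc n. A $$ (i, k) * B $$ (k, j))"
      using dims by (simp add: scalar_prod_def lessThan_atLeast0)
    also have "\<dots> = (\<Sum>k<Suc n. (if k = i then B $$ (i, j) else 0) + (if k = n \<and> i \<noteq> n then P (f i) (g n) / ?d * P (f n) (g j) else 0))"
      using ij by (intro sum.cong refl) (auto simp: A_def Bij)
    also have "\<dots> = B $$ (i, j) + (if i \<noteq> n then P (f i) (g n) / ?d * P (f n) (g j) else 0)"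
      using ij by (simp add: sum.distrib)
    also have "\<dots> = P (f i) (g j)"
      using ij d by (cases "i = n"; cases "j = n") (auto simp: Bij)
    finally show "?M $$ (i, j) = (A * B) $$ (i, j)" using ij by simp
  qed (use dims in auto)
  moreover have "det A = 1"
  proof -
    have "upper_triangular A" by (auto simp: upper_triangular_def A_def)
    moreover have "diag_mat A = replicate (Suc n) 1"
      by (intro nth_equalityI) (auto simp: diag_mat_def A_def simp del: upt_Suc replicate_Suc)
    ultimately show ?thesis using det_upper_triangular[OF _ dims(1)] by simp
  qed
  moreover have "det B = det B1 * ?d"
    unfolding B_def
    by (subst det_four_block_mat_upper_right_zero_col[of _ n]) (auto simp: B1_def B3_def B4_def det_single)
  ultimately show ?thesis
    using det_mult[OF dims] by (simp add: minor_def B1_def)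
qed

text \<open>The Schur complement of a Cauchy matrix is again a Cauchy matrix up to row and column
  factors, so induction on \<open>n\<close> applies.\<close>

lemma Cauchy_det:
  fixes x y :: "nat \<Rightarrow> 'a::field"
  assumes "\<And>i j. i < n \<Longrightarrow> j < n \<Longrightarrow> x i + y j \<noteq> 0"
  shows "minor n (\<lambda>i j. 1 / (x i + y j)) id id =
    (\<Prod>j<n. \<Prod>i<j. (x i - x j) * (y i - y j)) / (\<Prod>i<n. \<Prod>j<n. x i + y j)"
  using assms
proof (induction n)
  case 0
  then show ?case by (simp add: minor_Leibniz)
next
  case (Suc n)
  note nz = Suc.prems
  have "minor (Suc n) (\<lambda>i j. 1 / (x i + y j)) id id = 1 / (x n + y n) *
      minor n (\<lambda>i j. 1 / (x i + y j) - 1 / (x i + y n) * (1 / (x n + y j)) / (1 / (x n + y n))) id id"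
    by (subst minor_Schur) (use nz[of n n] in auto)
  also have "minor n (\<lambda>i j. 1 / (x i + y j) - 1 / (x i + y n) * (1 / (x n + y j)) / (1 / (x n + y n))) id id =
      minor n (\<lambda>i j. (x i - x n) / (x i + y n) * (1 / (x i + y j)) * ((y j - y n) / (x n + y j))) id id"
  proof (rule minor_cong, simp only: id_apply)
    fix i j assume "i < n" "j < n"
    then have "x i + y j \<noteq> 0" "x i + y n \<noteq> 0" "x n + y j \<noteq> 0" "x n + y n \<noteq> 0"
      using nz[of i j] nz[of i n] nz[of n j] nz[of n n] by auto
    then show "1 / (x i + y j) - 1 / (x i + y n) * (1 / (x n + y j)) / (1 / (x n + y n)) =
        (x i - x n) / (x i + y n) * (1 / (x i + y j)) * ((y j - y n) / (x n + y j))"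
      by (simp add: divide_simps) (simp add: algebra_simps)
  qed
  also have "\<dots> = (\<Prod>i<n. (x i - x n) / (x i + y n)) * (\<Prod>j<n. (y j - y n) / (x n + y j)) *
      ((\<Prod>j<n. \<Prod>i<j. (x i - x j) * (y i - y j)) / (\<Prod>i<n. \<Prod>j<n. x i + y j))"
    by (subst minor_scale, subst Suc.IH) (use nz in auto)
  finally show ?case
    by (simp add: prod_dividef prod.distrib mult_ac)
qed

section \<open>Minors for the coefficients of \<open>(1 - s)^(-z)\<close> and
  \<open>(1 - s)^z\<close>\<close>

definition rising_binomial :: "complex \<Rightarrow> nat \<Rightarrow> complex" where
  "rising_binomial z k = pochhammer z k / fact k"

lemma rising_binomial_0 [simp]: "rising_binomial z 0 = 1"
  by (simp add: rising_binomial_def)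

lemma rising_binomial_Suc: "rising_binomial z (Suc k) = rising_binomial z k * (z + of_nat k) / of_nat (Suc k)"
  by (simp add: rising_binomial_def pochhammer_Suc field_simps)

text \<open>The sum telescopes along diagonals, and the result is a Cauchy matrix up to row and column factors.\<close>

lemma Toeplitz_prod_rising_binomial:
  assumes z: "z \<notin> \<int>"
  shows "Toeplitz_prod (Abs_fps (rising_binomial z)) (rising_binomial (- z)) i j =
    (rising_binomial z i * (of_nat i + z)) * (1 / (of_nat i + (z - of_nat j))) * (rising_binomial (- z) j * (of_nat j - z) / (- z))"
proof (induction i arbitrary: j)
  case 0
  have "z \<noteq> of_nat j" "z \<noteq> 0" using z by auto
  then have "z - of_nat j \<noteq> 0" "z \<noteq> 0" by auto
  then show ?case by (simp add: Toeplitz_prod_def upper_Toeplitz_def field_simps)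
next
  case (Suc i)
  have nz: "of_int k + z \<noteq> 0" for k
    using z by (metis Ints_minus Ints_of_int add_eq_0_iff)
  show ?case
  proof (cases j)
    case 0
    have "Toeplitz_prod (Abs_fps (rising_binomial z)) (rising_binomial (- z)) (Suc i) 0 = rising_binomial z (Suc i)"
      unfolding Toeplitz_prod_def by (subst sum.atMost_Suc_shift) (simp add: upper_Toeplitz_def)
    then show ?thesis using 0 nz[of 0] nz[of "int (Suc i)"] by (simp add: field_simps)
  next
    case (Suc j')
    have "Toeplitz_prod (Abs_fps (rising_binomial z)) (rising_binomial (- z)) (Suc i) (Suc j') = rising_binomial z (Suc i) * rising_binomial (- z) (Suc j') + Toeplitz_prod (Abs_fps (rising_binomial z)) (rising_binomial (- z)) i j'"
      unfolding Toeplitz_prod_def by (subst sum.atMost_Suc_shift) (simp add: upper_Toeplitz_def cong: if_cong)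
    also have "\<dots> = (rising_binomial z (Suc i) * (of_nat (Suc i) + z)) * (1 / (of_nat (Suc i) + (z - of_nat (Suc j')))) * (rising_binomial (- z) (Suc j') * (of_nat (Suc j') - z) / (- z))"
    proof -
      have "z \<noteq> 0" "of_nat i + z \<noteq> 0" "of_nat j' - z \<noteq> 0" "of_nat i + (z - of_nat j') \<noteq> 0"
        "1 + complex_of_nat i \<noteq> 0" "1 + complex_of_nat j' \<noteq> 0"
        using nz[of 0] nz[of "int i"] nz[of "- int j'"] nz[of "int i - int j'"]
        by (auto simp: algebra_simps of_nat_Suc[symmetric] simp del: of_nat_Suc)
      then show ?thesis
        unfolding Suc.IH rising_binomial_Suc by (simp add: divide_simps) (simp add: algebra_simps)
    qed
    finally show ?thesis using Suc by simp
  qed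
qed

text \<open>Passing from \<open>l\<close> to \<open>Suc l\<close> multiplies the row factor of the
  Cauchy form by \<open>1 + z / Suc l\<close> and the column factor by
  \<open>1 - z / Suc l\<close>.\<close>

lemma rising_binomial_prod:
  assumes "z \<noteq> 0"
  shows "rising_binomial z l * (of_nat l + z) * (rising_binomial (- z) l * (of_nat l - z) / (- z)) = z * (\<Prod>k=1..l. 1 - z\<^sup>2 / of_nat k ^ 2)"
proof (induction l)
  case (Suc l)
  have ne: "1 + complex_of_nat l \<noteq> 0" by (metis of_nat_Suc of_nat_neq_0)
  have "rising_binomial z (Suc l) * (of_nat (Suc l) + z) * (rising_binomial (- z) (Suc l) * (of_nat (Suc l) - z) / (- z)) =
      (rising_binomial z l * (of_nat l + z) * (rising_binomial (- z) l * (of_nat l - z) / (- z))) * (1 - z\<^sup>2 / of_nat (Suc l) ^ 2)"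
    using ne assms unfolding rising_binomial_Suc by (simp add: divide_simps power2_eq_square) (simp add: algebra_simps)
  also have "\<dots> = z * (\<Prod>k=1..l. 1 - z\<^sup>2 / of_nat k ^ 2) * (1 - z\<^sup>2 / of_nat (Suc l) ^ 2)"
    by (simp only: Suc.IH)
  finally show ?case by (simp only: prod.nat_ivl_Suc' mult_ac)
qed (use assms in simp)

lemma prod_square_split:
  fixes g :: "nat \<Rightarrow> nat \<Rightarrow> 'a::comm_monoid_mult"
  shows "(\<Prod>i<n. \<Prod>j<n. g i j) = (\<Prod>i<n. g i i) * (\<Prod>j<n. \<Prod>i<j. g i j * g j i)"
  by (induction n) (simp_all add: prod.distrib mult_ac)

text \<open>In the Cauchy determinant the diagonal of the denominator gives \<open>z ^ n\<close>,
  cancelling the powers from \<open>rising_binomial_prod\<close>. A pair with difference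
  \<open>d\<close> contributes \<open>- d^2 / (z^2 - d^2)\<close>, the inverse of
  \<open>1 - z^2 / d^2\<close>.\<close>

lemma minor_rising_binomial:
  assumes z: "z \<notin> \<int>" and f: "inj_on f {..<n}"
  shows "minor n (Toeplitz_prod (Abs_fps (rising_binomial z)) (rising_binomial (- z))) f f * (\<Prod>j<n. \<Prod>i<j. 1 - z\<^sup>2 / (of_nat (f i) - of_nat (f j)) ^ 2)
    = (\<Prod>i<n. \<Prod>k=1..f i. 1 - z\<^sup>2 / of_nat k ^ 2)"
proof -
  have z0: "z \<noteq> 0" using z by auto
  have nz: "of_nat a + (z - of_nat b) \<noteq> 0" for a b :: nat
  proof
    assume "of_nat a + (z - of_nat b) = 0"
    then have "z = of_int (int b - int a)" by (simp add: algebra_simps)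
    then show False using z by simp
  qed
  let ?x = "\<lambda>i. of_nat (f i) :: complex" and ?y = "\<lambda>j. z - of_nat (f j) :: complex"
  have "minor n (Toeplitz_prod (Abs_fps (rising_binomial z)) (rising_binomial (- z))) f f =
      minor n (\<lambda>i j. (rising_binomial z i * (of_nat i + z)) * (1 / (of_nat i + (z - of_nat j))) * (rising_binomial (- z) j * (of_nat j - z) / (- z))) f f"
    by (intro minor_cong Toeplitz_prod_rising_binomial z)
  also have "\<dots> = (\<Prod>i<n. rising_binomial z (f i) * (of_nat (f i) + z) * (rising_binomial (- z) (f i) * (of_nat (f i) - z) / (- z))) *
      minor n (\<lambda>i j. 1 / (of_nat i + (z - of_nat j))) f f"
    by (subst minor_scale, subst prod.distrib[symmetric]) (simp only: mult.assoc)
  also have "minor n (\<lambda>i j. 1 / (of_nat i + (z - of_nat j))) f f = minor n (\<lambda>i j. 1 / (?x i + ?y j)) id id"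
    by (intro minor_cong) simp
  also have "\<dots> = (\<Prod>j<n. \<Prod>i<j. (?x i - ?x j) * (?y i - ?y j)) / (\<Prod>i<n. \<Prod>j<n. ?x i + ?y j)"
    by (rule Cauchy_det) (rule nz)
  also have "(\<Prod>i<n. \<Prod>j<n. ?x i + ?y j) = z ^ n * (\<Prod>j<n. \<Prod>i<j. (?x i + ?y j) * (?x j + ?y i))"
    by (subst prod_square_split) simp
  also have "(\<Prod>i<n. rising_binomial z (f i) * (of_nat (f i) + z) * (rising_binomial (- z) (f i) * (of_nat (f i) - z) / (- z))) =
      z ^ n * (\<Prod>i<n. \<Prod>k=1..f i. 1 - z\<^sup>2 / of_nat k ^ 2)"
    by (simp only: rising_binomial_prod[OF z0] prod.distrib prod_constant card_lessThan)
  finally have "minor n (Toeplitz_prod (Abs_fps (rising_binomial z)) (rising_binomial (- z))) f f = (\<Prod>i<n. \<Prod>k=1..f i. 1 - z\<^sup>2 / of_nat k ^ 2) *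
      (\<Prod>j<n. \<Prod>i<j. (?x i - ?x j) * (?y i - ?y j) / ((?x i + ?y j) * (?x j + ?y i)))"
    using z0 by (simp only: prod_dividef) simp
  moreover have "(\<Prod>j<n. \<Prod>i<j. (?x i - ?x j) * (?y i - ?y j) / ((?x i + ?y j) * (?x j + ?y i))) *
      (\<Prod>j<n. \<Prod>i<j. 1 - z\<^sup>2 / (?x i - ?x j) ^ 2) = 1"
    unfolding prod.distrib[symmetric]
  proof (intro prod.neutral ballI)
    fix j i assume "j \<in> {..<n}" "i \<in> {..<j}"
    then have "?x i - ?x j \<noteq> 0" using f by (auto simp: inj_on_eq_iff)
    then show "(?x i - ?x j) * (?y i - ?y j) / ((?x i + ?y j) * (?x j + ?y i)) * (1 - z\<^sup>2 / (?x i - ?x j) ^ 2) = 1"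
      using nz[of "f i" "f j"] nz[of "f j" "f i"]
      by (simp add: divide_simps power2_eq_square) (simp add: algebra_simps)
  qed
  ultimately show ?thesis by (simp add: mult.assoc)
qed

section \<open>Hook lengths\<close>

definition part :: "nat list \<Rightarrow> nat \<Rightarrow> nat" where
  "part ps i = (if i < length ps then ps ! i else 0)"

text \<open>The first-column hook lengths of the diagram, padded to \<open>n\<close> rows.\<close>

definition beads :: "nat \<Rightarrow> nat list \<Rightarrow> nat \<Rightarrow> nat" where
  "beads n ps i = part ps i + (n - 1 - i)"

lemma part_antimono:
  assumes "ps \<in> partitions N" "i \<le> k"
  shows "part ps k \<le> part ps i"
  using assms sorted_wrt_nth_less[of "(\<ge>)" ps i k]
  by (cases "i = k") (auto simp: partitions_def part_def)

lemma length_partition: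
  assumes "ps \<in> partitions N"
  shows "length ps \<le> N"
proof -
  have "length qs \<le> sum_list qs" if "0 \<notin> set qs" for qs :: "nat list"
    using that by (induction qs) (auto simp: Suc_le_eq)
  then show ?thesis using assms by (auto simp: partitions_def)
qed

lemma cells_part: "(i, j) \<in> cells ps \<longleftrightarrow> j < part ps i"
  by (auto simp: cells_def part_def)

lemma arm_part: "arm ps (i, j) = part ps i - Suc j"
proof -
  have "{l. (i, l) \<in> cells ps \<and> j < l} = {Suc j..<part ps i}"
    by (auto simp: cells_part)
  then show ?thesis by (simp add: arm_def)
qed

text \<open>Parts decrease, so the rows below \<open>i\<close> that meet column \<open>j\<close> are
  consecutive, beginning with \<open>Suc i\<close> if there are any.\<close>

lemma leg_bounds:
  assumes ps: "ps \<in> partitions N" and "i < k"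
  shows "j < part ps k \<Longrightarrow> k - i \<le> leg ps (i, j)"
    and "part ps k \<le> j \<Longrightarrow> leg ps (i, j) < k - i"
proof -
  let ?S = "{k. (k, j) \<in> cells ps \<and> i < k}"
  have fin: "finite ?S"
    by (rule finite_subset[of _ "{..<length ps}"]) (auto simp: cells_def)
  show "k - i \<le> leg ps (i, j)" if "j < part ps k"
  proof -
    have "{Suc i..k} \<subseteq> ?S"
      using that part_antimono[OF ps, of _ k] by (auto simp: cells_part intro: less_le_trans)
    from card_mono[OF fin this] show ?thesis by (simp add: leg_def)
  qed
  show "leg ps (i, j) < k - i" if "part ps k \<le> j"
  proof -
    have "k' < k" if "k' \<in> ?S" for k'
      using that \<open>part ps k \<le> j\<close> part_antimono[OF ps, of k k'] by (cases "k' < k") (auto simp: cells_part)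
    then have "?S \<subseteq> {Suc i..<k}" by auto
    from card_mono[OF _ this] show ?thesis using \<open>i < k\<close> by (simp add: leg_def)
  qed
qed

lemma leg_antimono:
  assumes "j \<le> j'"
  shows "leg ps (i, j') \<le> leg ps (i, j)"
proof -
  have "finite {k. (k, j) \<in> cells ps \<and> i < k}"
    by (rule finite_subset[of _ "{..<length ps}"]) (auto simp: cells_def)
  then show ?thesis using assms
    unfolding leg_def by (auto intro!: card_mono simp: cells_part)
qed

text \<open>The numbers from 1 to bead \<open>i\<close> are exactly the hook lengths of row
  \<open>i\<close> and the differences to later beads: both families are injective, they are
  disjoint and in range, and their sizes add up to \<open>part ps i + (n - 1 - i)\<close>.\<close>

lemma hook_row:
  fixes g :: "nat \<Rightarrow> 'a::comm_monoid_mult"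
  assumes ps: "ps \<in> partitions N" and n: "length ps \<le> n" and i: "i < n"
  shows "(\<Prod>k=1..beads n ps i. g k) =
    (\<Prod>j<part ps i. g (hook_length ps (i, j))) * (\<Prod>k\<in>{i<..<n}. g (beads n ps i - beads n ps k))"
proof -
  let ?H = "\<lambda>j. hook_length ps (i, j)" and ?B = "\<lambda>k. beads n ps i - beads n ps k"
  have H: "?H j = part ps i - j + leg ps (i, j)" if "j < part ps i" for j
    using that by (simp add: hook_length_def arm_part)
  have B: "?B k = part ps i - part ps k + (k - i)" "part ps k \<le> part ps i" if "k \<in> {i<..<n}" for k
    using that part_antimono[OF ps, of i k] by (auto simp: beads_def)
  have legn: "leg ps (i, j) \<le> n - 1 - i" for j
  proof -
    have "card {k. (k, j) \<in> cells ps \<and> i < k} \<le> card {i<..<n}"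
      using n by (intro card_mono) (auto simp: cells_def)
    then show ?thesis by (simp add: leg_def)
  qed
  have injH: "inj_on ?H {..<part ps i}"
  proof (rule linorder_inj_onI)
    fix j j' assume "j < j'" "j \<in> {..<part ps i}" "j' \<in> {..<part ps i}"
    then show "?H j \<noteq> ?H j'" using leg_antimono[of j j' ps i] by (simp add: H)
  qed auto
  have injB: "inj_on ?B {i<..<n}"
  proof (rule linorder_inj_onI)
    fix k k' assume kk: "k < k'" "k \<in> {i<..<n}" "k' \<in> {i<..<n}"
    then show "?B k \<noteq> ?B k'" using part_antimono[OF ps, of k k'] B(2)[OF kk(2)] by (simp add: B(1))
  qed auto
  \<comment> \<open>If row \<open>k\<close> reaches column \<open>j\<close>, the hook at
    \<open>j\<close> is longer than the difference to bead \<open>k\<close>; otherwise it is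
    shorter.\<close>
  have disj: "?H ` {..<part ps i} \<inter> ?B ` {i<..<n} = {}"
  proof (safe, goal_cases)
    case (1 _ j k)
    then have "part ps i - j + leg ps (i, j) = part ps i - part ps k + (k - i)"
      using H[of j] B(1)[of k] by simp
    moreover have "part ps k \<le> part ps i" using B(2)[of k] 1 by simp
    ultimately show ?case
      using leg_bounds[OF ps, of i k j] 1 by (cases "j < part ps k") auto
  qed
  have sub: "?H ` {..<part ps i} \<union> ?B ` {i<..<n} \<subseteq> {1..beads n ps i}"
  proof (safe, goal_cases)
    case (1 _ j)
    then show ?case using H[of j] legn[of j] by (simp add: beads_def, arith)
  next
    case (2 _ k)
    then show ?case using B[of k] by (simp add: beads_def, arith)
  qed
  have "card (?H ` {..<part ps i} \<union> ?B ` {i<..<n}) = card {1..beads n ps i}"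
  proof -
    have "card (?H ` {..<part ps i} \<union> ?B ` {i<..<n}) = card (?H ` {..<part ps i}) + card (?B ` {i<..<n})"
      by (rule card_Un_disjoint) (simp_all only: disj finite_imageI finite_lessThan finite_greaterThanLessThan)
    then show ?thesis
      using i by (simp only: card_image[OF injH] card_image[OF injB]) (simp add: beads_def)
  qed
  then have "{1..beads n ps i} = ?H ` {..<part ps i} \<union> ?B ` {i<..<n}"
    using sub by (intro card_subset_eq[symmetric]) auto
  then have "(\<Prod>k=1..beads n ps i. g k) = (\<Prod>k\<in>?H ` {..<part ps i} \<union> ?B ` {i<..<n}. g k)"
    by simp
  also have "\<dots> = (\<Prod>k\<in>?H ` {..<part ps i}. g k) * (\<Prod>k\<in>?B ` {i<..<n}. g k)"
    by (rule prod.union_disjoint) (simp_all only: disj finite_imageI finite_lessThan finite_greaterThanLessThan)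
  finally show ?thesis
    by (simp add: prod.reindex[OF injH] prod.reindex[OF injB])
qed

lemma prod_hook_lengths:
  fixes g :: "nat \<Rightarrow> 'a::comm_monoid_mult"
  assumes "length ps \<le> n"
  shows "(\<Prod>h\<in>#hook_lengths ps. g h) = (\<Prod>i<n. \<Prod>j<part ps i. g (hook_length ps (i, j)))"
proof -
  have "(\<Prod>h\<in>#hook_lengths ps. g h) = (\<Prod>c\<in>cells ps. g (hook_length ps c))"
    by (simp add: hook_lengths_def prod_unfold_prod_mset multiset.map_comp comp_def)
  also have "cells ps = (SIGMA i:{..<n}. {..<part ps i})"
    using assms by (auto simp: cells_def part_def split: if_splits)
  also have "(\<Prod>c\<in>(SIGMA i:{..<n}. {..<part ps i}). g (hook_length ps c)) = (\<Prod>i<n. \<Prod>j<part ps i. g (hook_length ps (i, j)))"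
    by (subst prod.Sigma) (auto simp: case_prod_unfold)
  finally show ?thesis .
qed

lemma beads_less:
  assumes "ps \<in> partitions N" "i < k" "k < n"
  shows "beads n ps k < beads n ps i"
  using part_antimono[OF assms(1), of i k] assms by (simp add: beads_def)

lemma prod_triangle_swap:
  fixes g :: "nat \<Rightarrow> nat \<Rightarrow> 'a::comm_monoid_mult"
  shows "(\<Prod>i<n. \<Prod>k\<in>{i<..<n}. g i k) = (\<Prod>k<n. \<Prod>i<k. g i k)"
proof -
  have "(\<Prod>i<n. \<Prod>k\<in>{i<..<n}. g i k) = (\<Prod>i<n. \<Prod>k\<in>{k. k \<in> {..<n} \<and> i < k}. g i k)"
    by (intro prod.cong) auto
  also have "\<dots> = (\<Prod>k<n. \<Prod>i\<in>{i. i \<in> {..<n} \<and> i < k}. g i k)"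
    by (rule prod.swap_restrict) auto
  also have "\<dots> = (\<Prod>k<n. \<Prod>i<k. g i k)"
    by (intro prod.cong) auto
  finally show ?thesis .
qed

text \<open>\<open>hook_row\<close> splits the right side of \<open>minor_rising_binomial\<close>
  into hooks and bead differences. The latter match the product on the left and are nonzero for
  nonintegral \<open>z\<close>, so they cancel.\<close>

lemma minor_beads_nonint:
  assumes z: "z \<notin> \<int>" and ps: "ps \<in> partitions N" and n: "length ps \<le> n"
  shows "minor n (Toeplitz_prod (Abs_fps (rising_binomial z)) (rising_binomial (- z))) (beads n ps) (beads n ps) =
    (\<Prod>h\<in>#hook_lengths ps. 1 - z\<^sup>2 / of_nat h ^ 2)"
proof -
  let ?l = "beads n ps" and ?g = "\<lambda>k. 1 - z\<^sup>2 / of_nat k ^ 2"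
  have less: "?l k < ?l i" if "i < k" "k < n" for i k
    using beads_less[OF ps that] .
  have inj: "inj_on ?l {..<n}"
    by (rule linorder_inj_onI) (use less in fastforce)+
  have "(\<Prod>i<n. \<Prod>k=1..?l i. ?g k) =
      (\<Prod>i<n. \<Prod>j<part ps i. ?g (hook_length ps (i, j))) * (\<Prod>i<n. \<Prod>k\<in>{i<..<n}. ?g (?l i - ?l k))"
    using hook_row[OF ps n, of _ ?g] by (simp add: prod.distrib)
  also have "(\<Prod>i<n. \<Prod>j<part ps i. ?g (hook_length ps (i, j))) = (\<Prod>h\<in>#hook_lengths ps. ?g h)"
    by (rule prod_hook_lengths[OF n, symmetric])
  also have "(\<Prod>i<n. \<Prod>k\<in>{i<..<n}. ?g (?l i - ?l k)) = (\<Prod>k<n. \<Prod>i<k. 1 - z\<^sup>2 / (of_nat (?l i) - of_nat (?l k)) ^ 2)"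
    unfolding prod_triangle_swap
    by (intro prod.cong refl) (use less in \<open>auto simp: of_nat_diff less_imp_le\<close>)
  finally have "minor n (Toeplitz_prod (Abs_fps (rising_binomial z)) (rising_binomial (- z))) ?l ?l * (\<Prod>k<n. \<Prod>i<k. 1 - z\<^sup>2 / (of_nat (?l i) - of_nat (?l k)) ^ 2) =
      (\<Prod>h\<in>#hook_lengths ps. ?g h) * (\<Prod>k<n. \<Prod>i<k. 1 - z\<^sup>2 / (of_nat (?l i) - of_nat (?l k)) ^ 2)"
    using minor_rising_binomial[OF z inj] by simp
  moreover have "(\<Prod>k<n. \<Prod>i<k. 1 - z\<^sup>2 / (of_nat (?l i) - of_nat (?l k)) ^ 2) \<noteq> 0"
  proof -
    have "1 - z\<^sup>2 / (of_nat a - of_nat b) ^ 2 \<noteq> 0" if "a \<noteq> b" for a b :: nat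
    proof
      assume *: "1 - z\<^sup>2 / (of_nat a - of_nat b) ^ 2 = 0"
      have "(of_nat a - of_nat b :: complex) \<noteq> 0" using that by simp
      with * have "z\<^sup>2 = (of_nat a - of_nat b) ^ 2" by simp
      then have "z = of_int (int a - int b) \<or> z = of_int (int b - int a)"
        by (auto simp: power2_eq_iff)
      then show False using z by auto
    qed
    then show ?thesis using less by fastforce
  qed
  ultimately show ?thesis by simp
qed

text \<open>For integral \<open>z\<close> some denominators of the Cauchy determinant vanish; the identity extends by continuity.\<close>

lemma minor_beads:
  assumes ps: "ps \<in> partitions N" and n: "length ps \<le> n"
  shows "minor n (Toeplitz_prod (Abs_fps (rising_binomial z)) (rising_binomial (- z))) (beads n ps) (beads n ps) =
    (\<Prod>h\<in>#hook_lengths ps. 1 - z\<^sup>2 / of_nat h ^ 2)" (is "?F z = ?G z")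
proof (cases "z \<in> \<int>")
  case False
  then show ?thesis by (rule minor_beads_nonint[OF _ ps n])
next
  case True
  \<comment> \<open>Since \<open>z\<close> is an integer here, every \<open>w k\<close> has nonzero
    imaginary part and is therefore nonintegral.\<close>
  define w where "w k = z + \<i> * of_real (inverse (real (Suc k)))" for k
  have rising_binomial: "continuous_on UNIV (\<lambda>z. rising_binomial z k)" for k
    unfolding rising_binomial_def pochhammer_prod by (intro continuous_intros) auto
  have ch': "continuous_on UNIV (\<lambda>z. rising_binomial (- z) k)" for k
    unfolding rising_binomial_def pochhammer_prod by (intro continuous_intros) auto
  have "continuous_on UNIV (\<lambda>z. upper_Toeplitz (rising_binomial (- z)) k j)" for k j
    by (cases "k \<le> j") (simp_all add: upper_Toeplitz_def ch')
  then have "continuous_on UNIV ?F"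
    unfolding minor_Leibniz Toeplitz_prod_def fps_nth_Abs_fps by (intro continuous_intros rising_binomial)
  moreover have "continuous_on UNIV ?G"
    unfolding prod_hook_lengths[OF n] divide_inverse by (intro continuous_intros)
  moreover have "w \<longlonglongrightarrow> z"
  proof -
    have "w \<longlonglongrightarrow> z + \<i> * of_real 0"
      unfolding w_def by (intro tendsto_intros LIMSEQ_inverse_real_of_nat)
    then show ?thesis by simp
  qed
  ultimately have F: "(\<lambda>k. ?F (w k)) \<longlonglongrightarrow> ?F z" and G: "(\<lambda>k. ?G (w k)) \<longlonglongrightarrow> ?G z"
    by (auto intro!: isCont_tendsto_compose[where l = z] simp: continuous_on_eq_continuous_at)
  have "w k \<notin> \<int>" for k
    using True by (auto simp: w_def elim!: Ints_cases simp: complex_eq_iff)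
  then have "?F (w k) = ?G (w k)" for k
    by (rule minor_beads_nonint[OF _ ps n])
  then show ?thesis
    using LIMSEQ_unique[OF F] G by simp
qed

section \<open>From constants in \<open>complex fps\<close> to complex minors\<close>

lemma geometric_fps_1_power: "fps_nth (geometric_fps (1 :: complex fps) ^ t) k = fps_const (rising_binomial (of_nat t) k)"
proof (induction t arbitrary: k)
  case 0
  then show ?case by (simp add: rising_binomial_def pochhammer_0_left)
next
  case (Suc t)
  have step: "rising_binomial (of_nat (Suc t)) (Suc k) = rising_binomial (of_nat (Suc t)) k + rising_binomial (of_nat t) (Suc k)" for k
  proof -
    have "pochhammer (1 + of_nat t :: complex) k * of_nat t = pochhammer (of_nat t) (Suc k)"
      by (simp add: pochhammer_rec mult.commute add.commute)
    then have "rising_binomial (of_nat t) (Suc k) = rising_binomial (of_nat (Suc t)) k * of_nat t / of_nat (Suc k)"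
      by (simp add: rising_binomial_def)
    then show ?thesis
      unfolding rising_binomial_Suc[of "of_nat (Suc t)"] by (simp add: field_simps del: of_nat_Suc) (simp add: field_simps)
  qed
  have "(\<Sum>i\<le>k. rising_binomial (of_nat t) i) = rising_binomial (of_nat (Suc t)) k"
    by (induction k) (simp_all add: step del: of_nat_Suc)
  moreover have "fps_nth (geometric_fps (1 :: complex fps) ^ Suc t) k = (\<Sum>i\<le>k. fps_const (rising_binomial (of_nat t) i))"
    unfolding power_Suc2 fps_mult_nth by (simp add: Suc atLeast0AtMost) (simp add: geometric_fps_def)
  moreover have "(\<Sum>i\<le>k. fps_const (rising_binomial (of_nat t) i)) = fps_const (\<Sum>i\<le>k. rising_binomial (of_nat t) i)"
    by (induction k) auto
  ultimately show ?case by simp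
qed

lemma sgn_choose_rising_binomial: "sgn_choose t k = fps_const (rising_binomial (- of_nat t) k)"
proof -
  have "rising_binomial (- of_nat t) k = (- 1) ^ k * of_nat (t choose k)"
    by (simp add: rising_binomial_def binomial_gbinomial gbinomial_pochhammer flip: power_mult_distrib)
  then show ?thesis
    by (simp add: sgn_choose_def fps_const_mult[symmetric] fps_of_nat fps_const_power[symmetric] flip: fps_const_neg del: fps_const_mult fps_const_power fps_const_neg)
qed

text \<open>The trace identity is applied over \<open>complex fps\<close> with
  \<open>q = fps_X\<close>, while the hook formula concerns complex minors; the ring homomorphism
  \<open>fps_const\<close> links them.\<close>

lemma minor_Toeplitz_prod_fps_const:
  "minor n (Toeplitz_prod (geometric_fps (1 :: complex fps) ^ t) (sgn_choose t)) f g =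
    fps_const (minor n (Toeplitz_prod (Abs_fps (rising_binomial (of_nat t))) (rising_binomial (- of_nat t))) f g)"
proof -
  interpret fc: comm_ring_hom "fps_const :: complex \<Rightarrow> complex fps"
    by unfold_locales auto
  have "Toeplitz_prod (geometric_fps 1 ^ t) (sgn_choose t) i j = fps_const (Toeplitz_prod (Abs_fps (rising_binomial (of_nat t))) (rising_binomial (- of_nat t)) i j)" for i j
    unfolding Toeplitz_prod_def fc.hom_sum
    by (intro sum.cong refl) (simp add: geometric_fps_1_power upper_Toeplitz_def sgn_choose_rising_binomial)
  then show ?thesis
    unfolding minor_Leibniz fc.hom_sum
    by (intro sum.cong refl) (simp add: fc.hom_mult fc.hom_prod)
qed

section \<open>Partitions as sets of beads\<close>

lemma part_inj:
  assumes ps: "ps \<in> partitions N" and qs: "qs \<in> partitions M" and eq: "\<And>i. part ps i = part qs i"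
  shows "ps = qs"
proof -
  have pos: "i < length rs \<longleftrightarrow> part rs i \<noteq> 0" if "rs \<in> partitions K" for rs K i
    using that by (auto simp: part_def partitions_def in_set_conv_nth)
  have "i < length ps \<longleftrightarrow> i < length qs" for i
    unfolding pos[OF ps] pos[OF qs] eq ..
  then have "length ps = length qs"
    by (metis less_irrefl nat_neq_iff)
  then show ?thesis
    using eq by (intro nth_equalityI) (metis part_def)+
qed

lemma sum_part:
  assumes "length ps \<le> n"
  shows "(\<Sum>i<n. part ps i) = sum_list ps"
proof -
  have "(\<Sum>i<n. part ps i) = (\<Sum>i<length ps. ps ! i)"
    using assms by (intro sum.mono_neutral_cong_right) (auto simp: part_def)
  then show ?thesis by (simp add: sum_list_sum_nth lessThan_atLeast0)
qed

lemma sum_beads: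
  assumes "length ps \<le> n"
  shows "(\<Sum>i<n. beads n ps i) = n * (n - 1) div 2 + sum_list ps"
proof -
  have "(\<Sum>i<n. n - 1 - i) = (\<Sum>i<n. i)"
    using sum.nat_diff_reindex[of "\<lambda>i. i" n] by simp
  also have "\<dots> = n * (n - 1) div 2"
    by (induction n) (auto simp: algebra_simps Sum_Ico_nat lessThan_atLeast0)
  finally have tri: "(\<Sum>i<n. n - 1 - i) = n * (n - 1) div 2" .
  show ?thesis
    unfolding beads_def sum.distrib sum_part[OF assms] tri by simp
qed

text \<open>Monotonicity puts all zeros of \<open>c\<close> at the end, and dropping them gives the
  partition.\<close>

lemma partition_of_antimono:
  assumes anti: "\<And>i j. i \<le> j \<Longrightarrow> j < n \<Longrightarrow> c j \<le> (c i :: nat)"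
  obtains ps where "ps \<in> partitions (\<Sum>i<n. c i)" "length ps \<le> n" "\<And>i. i < n \<Longrightarrow> part ps i = c i"
proof -
  have split: "\<exists>m. ys = filter (\<lambda>y. y \<noteq> 0) ys @ replicate m 0" if "sorted_wrt (\<ge>) ys" for ys :: "nat list"
    using that
  proof (induction ys)
    case (Cons y ys)
    show ?case
    proof (cases "y = 0")
      case True
      then have "\<forall>y\<in>set ys. y = 0"
        using Cons.prems by auto
      then have "filter (\<lambda>y. y \<noteq> 0) ys = []" "ys = replicate (length ys) 0"
        by (simp_all add: filter_empty_conv replicate_length_same)
      then have "y # ys = filter (\<lambda>y. y \<noteq> 0) (y # ys) @ replicate (Suc (length ys)) 0"
        using True by simp
      then show ?thesis ..
    qed (use Cons in auto)
  qed simp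
  define ys where "ys = map c [0..<n]"
  have sorted: "sorted_wrt (\<ge>) ys"
    using anti by (auto simp: ys_def sorted_wrt_iff_nth_less)
  then obtain m where m: "ys = filter (\<lambda>y. y \<noteq> 0) ys @ replicate m 0"
    using split by blast
  let ?ps = "filter (\<lambda>y. y \<noteq> 0) ys"
  have "sum_list ?ps = sum_list ys"
    by (subst (2) m) (simp add: sum_list_replicate)
  then have "sum_list ?ps = (\<Sum>i<n. c i)"
    by (simp add: ys_def interv_sum_list_conv_sum_set_nat lessThan_atLeast0)
  moreover have "sorted_wrt (\<ge>) ?ps"
    using sorted by (rule sorted_wrt_filter)
  moreover have len: "length ?ps + m = n"
    using arg_cong[OF m, of length] by (simp add: ys_def)
  moreover have "part ?ps i = c i" if "i < n" for i
  proof -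
    have "c i = ys ! i" using that by (simp add: ys_def)
    also have "\<dots> = (?ps @ replicate m 0) ! i" using m by simp
    finally show ?thesis using that len by (auto simp: nth_append part_def)
  qed
  ultimately show ?thesis
    by (intro that[of ?ps]) (auto simp: partitions_def)
qed

lemma strict_decreasing_unique:
  fixes a b :: "nat \<Rightarrow> nat"
  assumes "\<And>i j. i < j \<Longrightarrow> j < n \<Longrightarrow> a j < a i" "\<And>i j. i < j \<Longrightarrow> j < n \<Longrightarrow> b j < b i"
    and "a ` {..<n} = b ` {..<n}" "i < n"
  shows "a i = b i"
proof -
  have "map a (rev [0..<n]) = map b (rev [0..<n])"
    using assms(1-3)
    by (intro strict_sorted_equal) (auto simp: sorted_wrt_iff_nth_less rev_nth lessThan_atLeast0)
  then show ?thesis using assms(4) by simp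
qed

lemma strict_decreasing_ge:
  fixes a :: "nat \<Rightarrow> nat"
  assumes "\<And>i j. i < j \<Longrightarrow> j < n \<Longrightarrow> a j < a i" "i \<le> j" "j < n"
  shows "a j + (j - i) \<le> a i"
proof -
  have "a (i + d) + d \<le> a i" if "i + d < n" for d
    using that
  proof (induction d)
    case (Suc d)
    then show ?case using assms(1)[of "i + d" "i + Suc d"] by simp
  qed simp
  from this[of "j - i"] show ?thesis using assms by simp
qed

text \<open>\<open>b\<close> lists the values of \<open>f\<close> in decreasing order, and
  \<open>p\<close> sends an index to the rank of its value.\<close>

lemma injective_tuple_decomp:
  fixes f :: "nat \<Rightarrow> nat"
  assumes "inj_on f {..<n}"
  obtains p b where "p permutes {..<n}" "\<And>i j. i < j \<Longrightarrow> j < n \<Longrightarrow> b j < b i"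
    "\<And>i. i < n \<Longrightarrow> f i = b (p i)"
proof -
  define xs where "xs = rev (sorted_list_of_set (f ` {..<n}))"
  have len: "length xs = n" using assms by (simp add: xs_def card_image)
  have dec: "xs ! j < xs ! i" if "i < j" "j < n" for i j
    using that len strict_sorted_list_of_set[of "f ` {..<n}"]
    by (auto simp: xs_def rev_nth sorted_wrt_iff_nth_less)
  have setxs: "(\<lambda>i. xs ! i) ` {..<n} = f ` {..<n}"
  proof -
    have "set xs = f ` {..<n}" by (simp add: xs_def)
    then show ?thesis using len by (auto simp: set_conv_nth)
  qed
  have inj: "inj_on (\<lambda>i. xs ! i) {..<n}"
    by (rule linorder_inj_onI) (use dec in fastforce)+
  define g where "g = the_inv_into {..<n} (\<lambda>i. xs ! i)"
  have g: "bij_betw g (f ` {..<n}) {..<n}"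
    unfolding g_def setxs[symmetric] by (intro bij_betw_the_inv_into) (simp add: bij_betw_def inj)
  have gf: "bij_betw (g \<circ> f) {..<n} {..<n}"
    using bij_betw_trans[OF _ g, of f "{..<n}"] assms by (simp add: bij_betw_def)
  define p where "p i = (if i < n then g (f i) else i)" for i
  have "bij_betw p {..<n} {..<n}"
    using gf by (rule bij_betw_cong[THEN iffD1, rotated]) (auto simp: p_def)
  then have "p permutes {..<n}"
    by (rule bij_imp_permutes) (auto simp: p_def)
  moreover have "f i = xs ! p i" if "i < n" for i
    using that inj setxs by (auto simp: p_def g_def f_the_inv_into_f)
  ultimately show ?thesis using dec that by blast
qed

text \<open>Every such tuple is a permuted bead tuple in exactly one way, whence the factor
  \<open>fact n\<close>. The bound \<open>k \<le> n\<close> lets \<open>n\<close> rows hold every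
  partition of \<open>k\<close>, and \<open>W\<close> exceeds every possible entry.\<close>

lemma sum_injective_tuples:
  fixes G :: "(nat \<Rightarrow> nat) \<Rightarrow> 'a::comm_semiring_1"
  assumes k: "k \<le> n" and W: "n * (n - 1) div 2 + k < W"
    and perm: "\<And>f p. p permutes {..<n} \<Longrightarrow> G (f \<circ> p) = G f"
    and cong: "\<And>f f'. (\<And>i. i < n \<Longrightarrow> f i = f' i) \<Longrightarrow> G f = G f'"
  shows "(\<Sum>f | f \<in> {..<n} \<rightarrow>\<^sub>E {..<W} \<and> inj_on f {..<n} \<and> (\<Sum>i<n. f i) = n * (n - 1) div 2 + k. G f) =
    of_nat (fact n) * (\<Sum>ps\<in>partitions k. G (beads n ps))"
proof -
  let ?P = "{p. p permutes {..<n}}"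
  let ?T = "{f \<in> {..<n} \<rightarrow>\<^sub>E {..<W}. inj_on f {..<n} \<and> (\<Sum>i<n. f i) = n * (n - 1) div 2 + k}"
  let ?\<Phi> = "\<lambda>(p, ps). restrict (beads n ps \<circ> p) {..<n}"
  have len: "length ps \<le> n" if "ps \<in> partitions k" for ps
    using length_partition[OF that] k by simp
  have inj_b: "inj_on (beads n ps) {..<n}" if "ps \<in> partitions k" for ps
    by (rule linorder_inj_onI) (use beads_less[OF that] in fastforce)+
  have sum_b: "(\<Sum>i<n. beads n ps i) = n * (n - 1) div 2 + k" if "ps \<in> partitions k" for ps
    using sum_beads[OF len[OF that]] that by (simp add: partitions_def)
  have "bij_betw ?\<Phi> (?P \<times> partitions k) ?T"
  proof (rule bij_betw_imageI)
    show "inj_on ?\<Phi> (?P \<times> partitions k)"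
    proof (rule inj_onI, clarsimp)
      fix p ps q qs
      assume p: "p permutes {..<n}" and q: "q permutes {..<n}" and ps: "ps \<in> partitions k" and qs: "qs \<in> partitions k"
        and "restrict (beads n ps \<circ> p) {..<n} = restrict (beads n qs \<circ> q) {..<n}"
      then have eq: "beads n ps (p i) = beads n qs (q i)" if "i < n" for i
        using that by (metis comp_apply lessThan_iff restrict_apply')
      have "beads n ps ` {..<n} = (beads n ps \<circ> p) ` {..<n}" "beads n qs ` {..<n} = (beads n qs \<circ> q) ` {..<n}"
        using permutes_image[OF p] permutes_image[OF q] by (simp_all only: image_comp[symmetric])
      then have "beads n ps ` {..<n} = beads n qs ` {..<n}"
        using eq by (simp cong: image_cong_simp)
      then have beq: "beads n ps i = beads n qs i" if "i < n" for i
        using strict_decreasing_unique[of n "beads n ps" "beads n qs"] that beads_less[OF ps] beads_less[OF qs] by blast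
      have "part ps i = part qs i" for i
        using beq[of i] len[OF ps] len[OF qs] by (cases "i < n") (auto simp: beads_def part_def)
      then have "ps = qs" by (rule part_inj[OF ps qs])
      moreover have "p i = q i" for i
      proof (cases "i < n")
        case True
        then have "beads n ps (p i) = beads n ps (q i)" using eq beq permutes_in_image[OF q] \<open>ps = qs\<close> by simp
        then show ?thesis
          using True inj_b[OF ps] permutes_in_image[OF p, of i] permutes_in_image[OF q, of i] by (simp add: inj_on_eq_iff)
      qed (use p q in \<open>simp add: permutes_def\<close>)
      ultimately show "p = q \<and> ps = qs" by auto
    qed
    show "?\<Phi> ` (?P \<times> partitions k) = ?T"
    proof (rule Set.set_eqI, rule iffI)
      fix f assume "f \<in> ?\<Phi> ` (?P \<times> partitions k)"
      then obtain p ps where p: "p permutes {..<n}" and ps: "ps \<in> partitions k"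
        and f: "f = restrict (beads n ps \<circ> p) {..<n}" by auto
      have sum: "(\<Sum>i<n. f i) = n * (n - 1) div 2 + k"
        using sum.permute[OF p, of "beads n ps"] sum_b[OF ps] by (simp add: f)
      have "f i < W" if "i < n" for i
        using member_le_sum[of i "{..<n}" f] that sum W by simp
      then have "f \<in> {..<n} \<rightarrow>\<^sub>E {..<W}" by (auto simp: f)
      moreover have "inj_on f {..<n}"
      proof -
        have "inj_on (beads n ps) (p ` {..<n})"
          by (simp only: permutes_image[OF p] inj_b[OF ps])
        from comp_inj_on[OF permutes_inj_on[OF p] this] show ?thesis
          by (simp add: f inj_on_restrict_eq)
      qed
      ultimately show "f \<in> ?T" using sum by simp
    next
      fix f assume f: "f \<in> ?T"
      then obtain p b where p: "p permutes {..<n}" and b: "\<And>i j. i < j \<Longrightarrow> j < n \<Longrightarrow> b j < b i"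
        and fb: "\<And>i. i < n \<Longrightarrow> f i = b (p i)"
        using injective_tuple_decomp by (metis (mono_tags, lifting) mem_Collect_eq)
      \<comment> \<open>Subtracting the staircase turns strict into weak decrease; the truncated
        subtraction is exact because \<open>b i\<close> is at least
        \<open>n - 1 - i\<close>.\<close>
      define c where "c i = b i - (n - 1 - i)" for i
      have bc: "b i = c i + (n - 1 - i)" if "i < n" for i
      proof -
        have "b (n - 1) + (n - 1 - i) \<le> b i"
          by (rule strict_decreasing_ge[of n b]) (use b that in auto)
        then show ?thesis unfolding c_def by linarith
      qed
      have "c j \<le> c i" if "i \<le> j" "j < n" for i j
      proof -
        have "b j + (j - i) \<le> b i"
          by (rule strict_decreasing_ge[of n b]) (use b that in auto)
        then show ?thesis using bc[of i] bc[of j] that by linarith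
      qed
      from partition_of_antimono[of n c, OF this] obtain ps
        where ps: "ps \<in> partitions (\<Sum>i<n. c i)" "length ps \<le> n" "\<And>i. i < n \<Longrightarrow> part ps i = c i"
        by blast
      have bb: "b i = beads n ps i" if "i < n" for i
        using bc[OF that] ps(3)[OF that] by (simp add: beads_def)
      have "(\<Sum>i<n. f i) = (\<Sum>i<n. b i)"
        using sum.permute[OF p, of b] by (simp add: fb)
      also have "\<dots> = n * (n - 1) div 2 + (\<Sum>i<n. c i)"
        using sum_beads[OF ps(2)] ps(1) by (simp add: bb partitions_def)
      finally have "(\<Sum>i<n. c i) = k" using f by simp
      moreover have "f = restrict (beads n ps \<circ> p) {..<n}"
        using f fb bb permutes_in_image[OF p] by (intro ext) (auto simp: PiE_def extensional_def)
      ultimately show "f \<in> ?\<Phi> ` (?P \<times> partitions k)"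
        using p ps(1) by (intro image_eqI[of _ _ "(p, ps)"]) auto
    qed
  qed
  from sum.reindex_bij_betw[OF this, of G, symmetric]
  have "(\<Sum>f\<in>?T. G f) = (\<Sum>x\<in>?P \<times> partitions k. G (?\<Phi> x))" .
  also have "\<dots> = (\<Sum>(p, ps)\<in>?P \<times> partitions k. G (beads n ps))"
  proof (intro sum.cong refl, clarsimp)
    fix p ps assume p: "p permutes {..<n}"
    have "G (restrict (beads n ps \<circ> p) {..<n}) = G (beads n ps \<circ> p)" by (rule cong) simp
    then show "G (restrict (beads n ps \<circ> p) {..<n}) = G (beads n ps)" by (simp add: perm[OF p])
  qed
  also have "\<dots> = of_nat (fact n) * (\<Sum>ps\<in>partitions k. G (beads n ps))"
    by (subst sum.cartesian_product[symmetric]) (simp add: card_permutations)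
  finally show ?thesis by simp
qed

section \<open>The Nekrasov--Okounkov formula\<close>

lemma fps_X_power_dvd_iff:
  fixes f :: "'a::field fps"
  shows "fps_X ^ D dvd f \<longleftrightarrow> (\<forall>k<D. fps_nth f k = 0)"
proof
  assume "fps_X ^ D dvd f"
  then show "\<forall>k<D. fps_nth f k = 0"
    by (auto elim!: dvdE simp: fps_X_power_mult_nth)
next
  assume 0: "\<forall>k<D. fps_nth f k = 0"
  have "f = fps_X ^ D * Abs_fps (\<lambda>k. fps_nth f (k + D))"
    using 0 by (intro fps_ext) (simp add: fps_X_power_mult_nth not_less)
  then show "fps_X ^ D dvd f" by (rule dvdI)
qed

text \<open>The value of \<open>NO k\<close> at \<open>- t^2\<close>, see
  \<open>poly_NO_hook_sum\<close>.\<close>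

definition hook_sum :: "nat \<Rightarrow> nat \<Rightarrow> complex" where
  "hook_sum t k = (\<Sum>ps\<in>partitions k. \<Prod>h\<in>#hook_lengths ps. 1 - (of_nat t)\<^sup>2 / of_nat h ^ 2)"

text \<open>Only injective tuples with sum \<open>m\<close> contribute to coefficient
  \<open>m\<close>. There are none below the staircase sum \<open>n * (n - 1) div 2\<close>, and the
  next \<open>n\<close> coefficients are sums over bead tuples.\<close>

lemma weighted_trace_hook_sum:
  assumes W: "n * (n - 1) div 2 + n \<le> W"
  shows "fps_X ^ (n * (n - 1) div 2 + n) dvd weighted_trace n W fps_X (geometric_fps 1 ^ t) (sgn_choose t) -
    of_nat (fact n) * fps_X ^ (n * (n - 1) div 2) * Abs_fps (hook_sum t)"
  unfolding fps_X_power_dvd_iff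
proof (intro allI impI)
  fix m assume m: "m < n * (n - 1) div 2 + n"
  let ?C = "n * (n - 1) div 2"
  define G where "G f = minor n (Toeplitz_prod (Abs_fps (rising_binomial (of_nat t))) (rising_binomial (- of_nat t))) f f" for f
  have G0: "G f = 0" if "\<not> inj_on f {..<n}" for f
    unfolding G_def using that by (rule minor_eq_0_cols)
  have nth: "fps_nth (fps_X ^ s * fps_const c) m = (if s = m then c else 0)" for s and c :: complex
    by (auto simp: fps_X_power_mult_nth)
  have "fps_nth (weighted_trace n W fps_X (geometric_fps 1 ^ t) (sgn_choose t)) m = (\<Sum>f\<in>{..<n} \<rightarrow>\<^sub>E {..<W}. if (\<Sum>i<n. f i) = m then G f else 0)"
    unfolding weighted_trace_def minor_Toeplitz_prod_fps_const G_def[symmetric] fps_sum_nth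
    by (simp only: nth)
  also have "\<dots> = (\<Sum>f | f \<in> {..<n} \<rightarrow>\<^sub>E {..<W} \<and> inj_on f {..<n} \<and> (\<Sum>i<n. f i) = m. G f)"
  proof -
    have "finite ({..<n} \<rightarrow>\<^sub>E {..<W})" by (simp add: finite_PiE)
    then show ?thesis
      unfolding sum.inter_filter[OF \<open>finite _\<close>] by (intro sum.cong refl) (simp add: G0)
  qed
  also have "\<dots> = (if m < ?C then 0 else of_nat (fact n) * hook_sum t (m - ?C))"
  proof (cases "m < ?C")
    case True
    have "?C \<le> (\<Sum>i<n. f i)" if "inj_on f {..<n}" for f
    proof -
      have "inj_on (\<lambda>i. Suc (f i)) {..<n}" using that by (simp add: inj_on_def)
      from sum_inj_ge[OF _ _ this] show ?thesis by (simp add: sum_Suc image_iff)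
    qed
    with True have empty: "{f \<in> {..<n} \<rightarrow>\<^sub>E {..<W}. inj_on f {..<n} \<and> (\<Sum>i<n. f i) = m} = {}"
      by fastforce
    show ?thesis unfolding empty using True by simp
  next
    case False
    then obtain k where k: "m = ?C + k" "k < n" using m by (metis le_iff_add nat_add_left_cancel_less not_less)
    have "(\<Sum>f | f \<in> {..<n} \<rightarrow>\<^sub>E {..<W} \<and> inj_on f {..<n} \<and> (\<Sum>i<n. f i) = ?C + k. G f) =
        of_nat (fact n) * (\<Sum>ps\<in>partitions k. G (beads n ps))"
      using k W unfolding G_def by (intro sum_injective_tuples minor_permute minor_cong) auto
    also have "(\<Sum>ps\<in>partitions k. G (beads n ps)) = hook_sum t k"
      unfolding hook_sum_def G_def
    proof (intro sum.cong refl minor_beads)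
      fix ps assume "ps \<in> partitions k"
      then show "length ps \<le> n" using length_partition[of ps k] k by simp
    qed
    finally show ?thesis using k by simp
  qed
  also have "\<dots> = fps_nth (of_nat (fact n) * fps_X ^ ?C * Abs_fps (hook_sum t)) m"
    by (simp add: mult.assoc fps_X_power_mult_nth flip: fps_of_nat)
  finally show "fps_nth (weighted_trace n W fps_X (geometric_fps 1 ^ t) (sgn_choose t) - of_nat (fact n) * fps_X ^ ?C * Abs_fps (hook_sum t)) m = 0"
    by simp
qed

lemma partitions_0: "partitions 0 = {[]}"
proof -
  have "ps = []" if "ps \<in> partitions 0" for ps
    using that by (cases ps) (auto simp: partitions_def)
  then show ?thesis by (auto simp: partitions_def)
qed

lemma hook_sum_0: "hook_sum t 0 = 1"
  by (simp add: hook_sum_def partitions_0 hook_lengths_def cells_def)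

lemma hook_sum_1:
  assumes "k > 0"
  shows "hook_sum 1 k = 0"
  unfolding hook_sum_def
proof (intro sum.neutral ballI)
  fix ps assume ps: "ps \<in> partitions k"
  then have ne: "ps \<noteq> []" using assms by (auto simp: partitions_def)
  \<comment> \<open>The last cell of the last row has neither arm nor leg, so its hook length is 1
    and its factor is 0.\<close>
  define i where "i = length ps - 1"
  have i: "i < length ps" using ne by (simp add: i_def)
  define j where "j = ps ! i - 1"
  have j: "j < part ps i" "part ps i = Suc j"
  proof -
    have "ps ! i \<noteq> 0" using i ps by (auto simp: partitions_def in_set_conv_nth)
    then show "j < part ps i" "part ps i = Suc j" using i by (simp_all add: j_def part_def)
  qed
  have "leg ps (i, j) < Suc i - i"
    by (rule leg_bounds[OF ps]) (auto simp: part_def i_def)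
  then have "hook_length ps (i, j) = 1"
    by (simp add: hook_length_def arm_part j(2))
  moreover have "(i, j) \<in> cells ps" using j by (simp add: cells_part)
  ultimately have "1 \<in># hook_lengths ps"
    unfolding hook_lengths_def by (auto simp: finite_cells image_iff intro!: bexI[of _ "(i, j)"])
  then show "(\<Prod>h\<in>#hook_lengths ps. 1 - (complex_of_nat 1)\<^sup>2 / of_nat h ^ 2) = 0"
    by (auto simp: prod_mset_zero_iff image_iff intro!: bexI[of _ 1])
qed

lemma fps_X_power_dvd_cancel:
  fixes f g :: "'a::field fps"
  assumes "fps_nth g 0 \<noteq> 0" "fps_X ^ n dvd g * f"
  shows "fps_X ^ n dvd f"
proof -
  have "fps_X ^ n dvd inverse g * (g * f)" using assms(2) by simp
  also have "inverse g * (g * f) = f"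
    using inverse_mult_eq_1[OF assms(1)] by (simp flip: mult.assoc)
  finally show ?thesis .
qed

lemma dvd_diff_left:
  fixes d :: "'a::comm_ring_1"
  assumes "d dvd a - b" "d dvd a - c"
  shows "d dvd b - c"
  using dvd_diff[OF assms(2,1)] by simp

text \<open>Every nonempty diagram has a hook of length 1, so all terms of positive degree vanish at \<open>t = 1\<close>;
  this case determines the normalising factor for every other \<open>t\<close>.\<close>

lemma Euler_product_hook_sum:
  assumes "t \<ge> 1"
  defines "E \<equiv> \<lambda>D. \<Prod>m=1..D. 1 - fps_X ^ m :: complex fps"
  shows "fps_X ^ n dvd E (n * (n - 1) div 2 + n) * Abs_fps (hook_sum t) - E (n * (n - 1) div 2 + n) ^ (t * t)"
proof -
  let ?C = "n * (n - 1) div 2"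
  let ?D = "?C + n"
  let ?W = "?D + t" and ?E = "E ?D"
  let ?H = "\<lambda>t. Abs_fps (hook_sum t)" and ?c = "of_nat (fact n) * fps_X ^ ?C :: complex fps"
  let ?T = "\<lambda>t. weighted_trace n ?W (fps_X :: complex fps) (geometric_fps 1 ^ t) (sgn_choose t)"
  let ?S = "\<Sum>f | f \<in> {..<n} \<rightarrow>\<^sub>E {..<?W} \<and> inj_on f {..<n}. fps_X ^ (\<Sum>i<n. f i) :: complex fps"
  have T: "fps_X ^ ?D dvd ?E ^ (s * s) * ?S - ?c * ?H s" if "s \<le> t" for s
  proof -
    have "fps_X ^ ?D dvd ?T s - ?E ^ (s * s) * ?S"
      unfolding E_def using that by (intro weighted_trace_eq) auto
    moreover have "fps_X ^ ?D dvd ?T s - ?c * ?H s"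
      by (intro weighted_trace_hook_sum) auto
    ultimately show ?thesis
      by (rule dvd_diff_left)
  qed
  have "?H 1 = 1"
    by (intro fps_ext) (simp add: hook_sum_0 hook_sum_1[unfolded One_nat_def])
  then have T1: "fps_X ^ ?D dvd ?E * ?S - ?c"
    using T[OF assms(1)] by simp
  \<comment> \<open>Cross-multiplying the cases \<open>1\<close> and \<open>t\<close> eliminates the
    tuple sum \<open>?S\<close>. Cancelling \<open>fps_X ^ ?C\<close> afterwards lowers the
    precision from \<open>?D\<close> to \<open>n\<close>.\<close>
  have "fps_X ^ ?D dvd ?E ^ (t * t) * (?E * ?S - ?c) - ?E * (?E ^ (t * t) * ?S - ?c * ?H t)"
    by (rule dvd_diff[OF dvd_mult[OF T1] dvd_mult[OF T[OF order_refl]]])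
  moreover have "p * (e * s - f * x) - e * (p * s - f * x * h) = x * (f * (e * h - p))" for p e s f x h :: "complex fps"
    by (simp add: algebra_simps)
  ultimately have "fps_X ^ ?C * fps_X ^ n dvd fps_X ^ ?C * (of_nat (fact n) * (?E * ?H t - ?E ^ (t * t)))"
    by (simp only: power_add)
  then have "fps_X ^ n dvd of_nat (fact n) * (?E * ?H t - ?E ^ (t * t))"
    by (subst (asm) dvd_times_left_cancel_iff) simp_all
  then show ?thesis
    by (rule fps_X_power_dvd_cancel[rotated]) (simp flip: fps_of_nat)
qed

section \<open>The recurrence by logarithmic differentiation\<close>

definition sigma_le :: "nat \<Rightarrow> nat \<Rightarrow> nat" where
  "sigma_le D k = (if k = 0 then 0 else \<Sum>m | m \<in> {1..D} \<and> m dvd k. m)"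

text \<open>Each factor \<open>1 - fps_X ^ m\<close> contributes the series of all
  \<open>m * fps_X ^ (m * j)\<close> with \<open>j \<ge> 1\<close>; collecting equal powers gives
  sums over divisors up to \<open>D\<close>. Coefficient 0 needs its own clause in
  \<open>sigma_le\<close> because every \<open>m\<close> divides 0.\<close>

lemma Euler_product_deriv:
  "fps_X * fps_deriv (\<Prod>m=1..D. 1 - fps_X ^ m) =
    - (\<Prod>m=1..D. 1 - fps_X ^ m) * (Abs_fps (\<lambda>k. of_nat (sigma_le D k)) :: complex fps)"
proof (induction D)
  case 0
  have "Abs_fps (\<lambda>k. of_nat (sigma_le 0 k)) = (0 :: complex fps)"
    by (intro fps_ext) (simp add: sigma_le_def)
  then show ?case by simp
next
  case (Suc D)
  let ?P = "\<Prod>m=1..D. 1 - fps_X ^ m :: complex fps" and ?S = "\<lambda>D. Abs_fps (\<lambda>k. of_nat (sigma_le D k)) :: complex fps"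
  define u where "u = (1 - fps_X ^ Suc D :: complex fps)"
  define A where "A = Abs_fps (\<lambda>k. if k > 0 \<and> Suc D dvd k then of_nat (Suc D) else 0 :: complex)"
  have SA: "?S (Suc D) = ?S D + A"
  proof (rule fps_ext)
    fix k
    have "{m. m \<in> {1..Suc D} \<and> m dvd k} = {m. m \<in> {1..D} \<and> m dvd k} \<union> (if Suc D dvd k then {Suc D} else {})"
      by (auto simp: le_Suc_eq)
    then have "sigma_le (Suc D) k = sigma_le D k + (if k > 0 \<and> Suc D dvd k then Suc D else 0)"
      by (auto simp: sigma_le_def)
    then show "fps_nth (?S (Suc D)) k = fps_nth (?S D + A) k"
      by (simp add: A_def del: of_nat_Suc)
  qed
  have uA: "u * A = of_nat (Suc D) * fps_X ^ Suc D"
  proof (rule fps_ext)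
    fix k
    have "fps_nth (u * A) k = fps_nth A k - (if k < Suc D then 0 else fps_nth A (k - Suc D))"
      by (simp only: u_def left_diff_distrib mult_1_left fps_sub_nth fps_X_power_mult_nth)
    also have "\<dots> = (if k = Suc D then of_nat (Suc D) else 0)"
      by (auto simp: A_def dvd_diff_nat dvd_minus_self not_less simp del: of_nat_Suc dest: dvd_imp_le)
    also have "\<dots> = fps_nth (of_nat (Suc D) * fps_X ^ Suc D) k"
      by (simp add: fps_X_power_nth del: of_nat_Suc power_Suc flip: fps_of_nat)
    finally show "fps_nth (u * A) k = fps_nth (of_nat (Suc D) * fps_X ^ Suc D) k" .
  qed
  have du: "fps_X * fps_deriv u = - (u * A)"
  proof -
    have "fps_deriv (fps_X ^ Suc D) = (of_nat (Suc D) * fps_X ^ D :: complex fps)"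
      by (simp add: fps_deriv_power flip: fps_of_nat del: of_nat_Suc power_Suc)
    then show ?thesis unfolding uA by (simp add: u_def mult_ac del: of_nat_Suc)
  qed
  have "fps_X * fps_deriv (?P * u) = (fps_X * fps_deriv ?P) * u + ?P * (fps_X * fps_deriv u)"
    by (simp add: algebra_simps)
  also have "\<dots> = - (?P * u) * (?S D + A)"
    unfolding Suc.IH du by (simp add: algebra_simps)
  finally show ?case
    unfolding SA u_def by simp
qed

text \<open>Modulo a power of \<open>fps_X\<close>, \<open>P * H\<close> equals
  \<open>P ^ (t * t)\<close>, so the logarithmic derivative of \<open>H\<close> is
  \<open>t * t - 1\<close> times that of \<open>P\<close>. The error \<open>G\<close> is carried
  along and stays divisible under \<open>fps_X\<close> times the derivative.\<close>

lemma hook_sum_recurrence: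
  assumes t: "t \<ge> 1"
  shows "of_nat k * hook_sum t k = (1 - of_nat t ^ 2) * (\<Sum>i=1..k. of_nat (\<Sum>d | d dvd i. d) * hook_sum t (k - i))"
proof -
  \<comment> \<open>Precision \<open>Suc k\<close> reaches coefficient \<open>k\<close>, and
    \<open>D \<ge> k\<close> makes the truncated divisor sums complete up to
    \<open>k\<close>.\<close>
  let ?n = "Suc k"
  define D where "D = ?n * (?n - 1) div 2 + ?n"
  define P where "P = (\<Prod>m=1..D. 1 - fps_X ^ m :: complex fps)"
  define S where "S = (Abs_fps (\<lambda>k. of_nat (sigma_le D k)) :: complex fps)"
  define H where "H = Abs_fps (hook_sum t)"
  obtain R where "P * H - P ^ (t * t) = fps_X ^ ?n * R"
    using Euler_product_hook_sum[OF t, of ?n] unfolding D_def[symmetric] P_def[symmetric] H_def[symmetric]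
    by (auto simp: dvd_def)
  then obtain G where G: "P ^ (t * t) = P * H - G" "fps_X ^ ?n dvd G"
    by (metis dvd_triv_left diff_diff_eq2 add_diff_cancel_left')
  have dP: "fps_X * fps_deriv P = - P * S"
    unfolding P_def S_def by (rule Euler_product_deriv)
  have P0: "fps_nth P 0 \<noteq> 0"
    proof -
    have "fps_nth (\<Prod>m=1..d. 1 - fps_X ^ m :: complex fps) 0 = 1" for d
      by (induction d) auto
    then show ?thesis by (simp add: P_def)
  qed
  have dG: "fps_X ^ ?n dvd fps_X * fps_deriv G"
    using G(2) unfolding fps_X_power_dvd_iff by auto
  have "fps_X * fps_deriv (P * H - G) = P * (fps_X * fps_deriv H - S * H) - fps_X * fps_deriv G"
    using arg_cong[OF dP, of "\<lambda>u. u * H"] by (simp add: algebra_simps)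
  moreover have "fps_X * fps_deriv (P ^ (t * t)) = of_nat (t * t) * P ^ (t * t) * - S"
  proof -
    have "t * t \<noteq> 0" using t by simp
    then obtain s where s: "t * t = Suc s" by (cases "t * t") auto
    have "fps_X * fps_deriv (P ^ Suc s) = of_nat (Suc s) * P ^ s * (fps_X * fps_deriv P)"
      by (subst fps_deriv_power) (simp add: mult_ac flip: fps_of_nat del: of_nat_Suc power_Suc)
    then show ?thesis unfolding s dP by (simp add: mult_ac del: of_nat_Suc)
  qed
  ultimately have "P * (fps_X * fps_deriv H - S * H) - fps_X * fps_deriv G = of_nat (t * t) * (P * H - G) * - S"
    unfolding G(1) by (simp only:)
  then have "P * (fps_X * fps_deriv H - (1 - of_nat (t * t)) * (S * H)) = fps_X * fps_deriv G + G * (of_nat (t * t) * S)"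
    by (simp add: algebra_simps)
  then have "fps_X ^ ?n dvd P * (fps_X * fps_deriv H - (1 - of_nat (t * t)) * (S * H))"
    using dvd_add[OF dG dvd_mult2[OF G(2)]] by simp
  then have "fps_X ^ ?n dvd fps_X * fps_deriv H - (1 - of_nat (t * t)) * (S * H)"
    by (rule fps_X_power_dvd_cancel[OF P0])
  then have "fps_nth (fps_X * fps_deriv H) k = fps_nth ((1 - of_nat (t * t)) * (S * H)) k"
    unfolding fps_X_power_dvd_iff by auto
  moreover have "fps_nth (fps_X * fps_deriv H) k = of_nat k * hook_sum t k"
    by (cases k) (simp_all add: H_def)
  moreover have "(1 - of_nat (t * t) :: complex fps) = fps_const (1 - of_nat t ^ 2)"
    by (simp add: power2_eq_square flip: fps_of_nat fps_const_sub)
  moreover have "fps_nth (S * H) k = (\<Sum>i=1..k. of_nat (\<Sum>d | d dvd i. d) * hook_sum t (k - i))"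
  proof -
    have "sigma_le D i = (\<Sum>d | d dvd i. d)" if "i \<in> {1..k}" for i
    proof -
      have "k \<le> D" by (simp add: D_def)
      then have "{m \<in> {1..D}. m dvd i} = {d. d dvd i}"
        using that by (auto dest: dvd_imp_le intro: Nat.gr0I)
      then show ?thesis using that by (simp add: sigma_le_def)
    qed
    then show ?thesis
      unfolding fps_mult_nth by (subst sum.atLeast_Suc_atMost) (auto simp: S_def H_def sigma_le_def intro!: sum.cong)
  qed
  ultimately show ?thesis by simp
qed

lemma poly_NO_hook_sum: "poly (NO k) (- (of_nat t ^ 2)) = hook_sum t k"
proof -
  have "poly (\<Prod>h\<in>#M. [:1, 1 / of_nat h ^ 2:]) z = (\<Prod>h\<in>#M. 1 + z / of_nat h ^ 2)" for z :: complex and M :: "nat multiset"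
    by (induction M) (auto simp: algebra_simps)
  then show ?thesis by (simp add: NO_def hook_sum_def poly_sum)
qed

lemma NO_0: "NO 0 = 1"
  by (simp add: NO_def partitions_0 hook_lengths_def cells_def)

text \<open>Both sides are polynomials and agree at \<open>z = - t\<^sup>2\<close> for every positive integer \<open>t\<close>.\<close>

theorem NO_recurrence:
  "of_nat k * NO k = [:1, 1:] * (\<Sum>i=1..k. of_nat (\<Sum>d | d dvd i. d) * NO (k - i))" (is "?L = ?R")
proof (rule ccontr)
  assume "?L \<noteq> ?R"
  then have "finite {z. poly (?L - ?R) z = 0}"
    by (intro poly_roots_finite) simp
  moreover have "range (\<lambda>t. - (of_nat (Suc t) ^ 2)) \<subseteq> {z. poly (?L - ?R) z = 0}"
  proof (rule image_subsetI, rule CollectI)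
    fix t
    have "poly ?L (- (of_nat (Suc t) ^ 2)) = poly ?R (- (of_nat (Suc t) ^ 2))"
      using hook_sum_recurrence[of "Suc t" k]
      by (simp add: poly_sum poly_NO_hook_sum left_diff_distrib del: of_nat_Suc of_nat_sum)
    then show "poly (?L - ?R) (- (of_nat (Suc t) ^ 2)) = 0" by (simp only: poly_diff) simp
  qed
  moreover have "infinite (range (\<lambda>t. - (of_nat (Suc t) ^ 2) :: complex))"
  proof (rule range_inj_infinite, rule injI)
    fix x y assume "- (of_nat (Suc x) ^ 2) = (- (of_nat (Suc y) ^ 2) :: complex)"
    then have "(of_nat (Suc x ^ 2) :: complex) = of_nat (Suc y ^ 2)" by (simp del: of_nat_Suc)
    then have "Suc x ^ 2 = Suc y ^ 2" by (simp only: of_nat_eq_iff)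
    then show "x = y" by (simp add: power2_eq_iff)
  qed
  ultimately show False using finite_subset by blast
qed

section \<open>Inverting the generating function of divisor sums\<close>

definition sigma :: "nat \<Rightarrow> nat" where
  "sigma k = (\<Sum>d | d dvd k. d)"

definition alt_sum :: "nat \<Rightarrow> real" where
  "alt_sum y = (\<Sum>d=1..y. (- 1) ^ (d + 1) * real d)"

lemma alt_sum_eq: "alt_sum y = (if even y then - real (y div 2) else real ((y + 1) div 2))"
  unfolding alt_sum_def by (induction y) (auto simp: field_simps elim!: evenE oddE)

lemma alt_sum_le: "alt_sum y \<le> real y"
  by (auto simp: alt_sum_eq elim!: oddE)

text \<open>Write \<open>k = d * e\<close> and sum over \<open>d\<close> first: for odd
  \<open>e\<close> the sign alternates with \<open>d\<close>, for even \<open>e\<close> it is always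
  negative.\<close>

lemma alternating_sigma_sum:
  "(\<Sum>k=1..x. (- 1) ^ (k + 1) * real (sigma k)) =
    (\<Sum>e=1..x. if odd e then alt_sum (x div e) else - real (\<Sum>{1..x div e}))"
proof -
  let ?f = "\<lambda>k d. (- 1) ^ (k + 1) * real d"
  have "(\<Sum>k=1..x. (- 1) ^ (k + 1) * real (sigma k)) = (\<Sum>(k, d)\<in>(SIGMA k:{1..x}. {d. d dvd k}). ?f k d)"
    by (subst sum.Sigma[symmetric]) (auto simp: sigma_def sum_distrib_left)
  also have "\<dots> = (\<Sum>(e, d)\<in>(SIGMA e:{1..x}. {1..x div e}). ?f (d * e) d)"
    by (rule sum.reindex_bij_witness[of _ "\<lambda>(e, d). (d * e, d)" "\<lambda>(k, d). (k div d, d)"])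
       (auto simp: less_eq_div_iff_mult_less_eq Suc_le_eq div_greater_zero_iff dvd_imp_le mult.commute
             intro: dvd_pos_nat order.trans[OF div_le_dividend])
  also have "\<dots> = (\<Sum>e=1..x. \<Sum>d=1..x div e. ?f (d * e) d)"
    by (subst sum.Sigma) auto
  also have "\<dots> = (\<Sum>e=1..x. if odd e then alt_sum (x div e) else - real (\<Sum>{1..x div e}))"
  proof (intro sum.cong refl)
    fix e
    show "(\<Sum>d=1..x div e. ?f (d * e) d) = (if odd e then alt_sum (x div e) else - real (\<Sum>{1..x div e}))"
      by (auto simp: alt_sum_def sum_negf[symmetric] minus_one_power_iff intro!: sum.cong)
  qed
  finally show ?thesis .
qed

text \<open>In the sum over cofactors \<open>e\<close>, the terms for \<open>e = 2i\<close> and \<open>e = 2i + 1\<close> add up to at most 0;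
  only \<open>e = 1\<close> remains.\<close>

lemma alternating_sigma_sum_le:
  "(\<Sum>k=1..x. (- 1) ^ (k + 1) * real (sigma k)) \<le> alt_sum x"
  "\<lbrakk>even x; x > 0\<rbrakk> \<Longrightarrow> (\<Sum>k=1..x. (- 1) ^ (k + 1) * real (sigma k)) \<le> alt_sum x - 1"
proof -
  define g where "g e = (if odd e then alt_sum (x div e) else - real (\<Sum>{1..x div e}))" for e
  have g_odd: "g (2 * i + 1) \<le> real (x div (2 * i + 1))" for i
    by (simp add: g_def alt_sum_le)
  have g_even: "g (2 * i) \<le> - real (x div (2 * i))" for i
  proof -
    have "y \<le> \<Sum>{1..y}" for y :: nat by (induction y) auto
    then have "real (x div (2 * i)) \<le> real (\<Sum>{1..x div (2 * i)})"
      by (simp only: of_nat_le_iff)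
    then show ?thesis by (simp add: g_def del: of_nat_sum)
  qed
  have pair: "g (2 * i) + g (2 * i + 1) \<le> 0" if "i > 0" for i
    using g_odd[of i] g_even[of i] div_le_mono2[of "2 * i" "2 * i + 1" x] that by linarith
  have g0: "g e = 0" if "e > x" for e
    using that by (simp add: g_def alt_sum_eq)
  have upto: "(\<Sum>e=1..2 * m + 1. g e) = g 1 + (\<Sum>i=1..m. g (2 * i) + g (2 * i + 1))" for m
    by (induction m) auto
  have "(\<Sum>k=1..x. (- 1) ^ (k + 1) * real (sigma k)) = (\<Sum>e=1..x. g e)"
    unfolding g_def by (rule alternating_sigma_sum)
  also have "\<dots> = (\<Sum>e=1..2 * x + 1. g e)"
    by (rule sum.mono_neutral_left) (auto intro: g0)
  also have "\<dots> = alt_sum x + (\<Sum>i=1..x. g (2 * i) + g (2 * i + 1))"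
    unfolding upto by (simp add: g_def)
  finally have eq: "(\<Sum>k=1..x. (- 1) ^ (k + 1) * real (sigma k)) = alt_sum x + (\<Sum>i=1..x. g (2 * i) + g (2 * i + 1))" .
  show "(\<Sum>k=1..x. (- 1) ^ (k + 1) * real (sigma k)) \<le> alt_sum x"
    unfolding eq using sum_nonpos[of "{1..x}" "\<lambda>i. g (2 * i) + g (2 * i + 1)"] pair by force
  assume "even x" "x > 0"
  \<comment> \<open>The pair \<open>i = 1\<close> is at most \<open>x div 3 - x div 2\<close>, which
    is at most -1 for even positive \<open>x\<close>.\<close>
  then have "x div 3 + 1 \<le> x div 2" by (elim evenE) auto
  then have "g (2 * 1) + g (2 * 1 + 1) \<le> - 1"
    using g_odd[of 1] g_even[of 1] by simp
  moreover have "(\<Sum>i\<in>{1..x} - {1}. g (2 * i) + g (2 * i + 1)) \<le> 0"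
    by (intro sum_nonpos) (use pair in force)
  ultimately show "(\<Sum>k=1..x. (- 1) ^ (k + 1) * real (sigma k)) \<le> alt_sum x - 1"
    unfolding eq using \<open>x > 0\<close> by (subst sum.remove[of _ 1]) auto
qed

text \<open>The signs come from the substitution \<open>z = - x\<close>; the index shift makes the
  constant term 1, so the series is invertible.\<close>

definition sigma_fps :: "real fps" where
  "sigma_fps = Abs_fps (\<lambda>k. (- 1) ^ k * real (sigma (Suc k)))"

lemma sigma_1: "sigma (Suc 0) = 1"
  by (simp add: sigma_def)

text \<open>Multiplying \<open>sigma_fps\<close> by \<open>(1 + q) / (1 - q)\<close> gives a series \<open>1 - N\<close> with \<open>N\<close> coefficientwise
  nonnegative, hence the inverse of \<open>sigma_fps\<close> is \<open>(1 + q) / (1 - q) \<sqdot> (1 + N + N\<^sup>2 + \<dots>)\<close>.\<close>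

lemma inverse_sigma_fps_pos: "fps_nth (inverse sigma_fps) n > 0"
proof (induction n rule: less_induct)
  case (less n)
  let ?D = "inverse sigma_fps"
  \<comment> \<open>The expansion of \<open>(1 + q) / (1 - q)\<close>.\<close>
  define A :: "real fps" where "A = Abs_fps (\<lambda>k. if k = 0 then 1 else 2)"
  define C where "C = sigma_fps * A"
  define E where "E x = (\<Sum>k=1..x. (- 1) ^ (k + 1) * real (sigma k))" for x
  have E: "E x = (\<Sum>k<x. fps_nth sigma_fps k)" for x
    unfolding E_def by (simp add: sum.atLeast1_atMost_eq sigma_fps_def)
  have C_eq: "fps_nth C k = E (Suc k) + E k" for k
  proof -
    have "fps_nth C k = (\<Sum>i\<le>k. fps_nth sigma_fps i * (if i = k then 1 else 2))"
      unfolding C_def fps_mult_nth A_def by (intro sum.cong) auto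
    also have "\<dots> = (\<Sum>i<k. fps_nth sigma_fps i * 2) + fps_nth sigma_fps k"
      unfolding lessThan_Suc_atMost[symmetric] by simp
    finally show ?thesis by (simp add: E sum_distrib_right[symmetric])
  qed
  \<comment> \<open>The bounds on \<open>E (Suc k)\<close> and \<open>E k\<close> add up to exactly
    0; for even \<open>k\<close> this takes the sharper bound on \<open>E k\<close>.\<close>
  have C_le: "fps_nth C k \<le> 0" if "k > 0" for k
  proof (cases "even k")
    case True
    then show ?thesis
      unfolding C_eq E_def using alternating_sigma_sum_le(1)[of "Suc k"] alternating_sigma_sum_le(2)[of k] that
      by (auto simp: alt_sum_eq elim!: evenE)
  next
    case False
    then show ?thesis
      unfolding C_eq E_def using alternating_sigma_sum_le(1)[of "Suc k"] alternating_sigma_sum_le(1)[of k]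
      by (auto simp: alt_sum_eq elim!: oddE)
  qed
  have s0: "fps_nth sigma_fps 0 = 1" by (simp add: sigma_fps_def sigma_1)
  then have "?D * C = A"
    unfolding C_def using inverse_mult_eq_1[of sigma_fps] by (simp flip: mult.assoc)
  moreover have "fps_nth C 0 = 1" by (simp add: C_def A_def s0)
  ultimately have "fps_nth A n = fps_nth ?D n + (\<Sum>i<n. fps_nth ?D i * fps_nth C (n - i))"
    by (simp add: fps_mult_nth atLeast0AtMost lessThan_Suc_atMost[symmetric] flip: \<open>?D * C = A\<close>)
  moreover have "(\<Sum>i<n. fps_nth ?D i * fps_nth C (n - i)) \<le> 0"
    using less C_le by (intro sum_nonpos mult_nonneg_nonpos) (auto intro: less_imp_le)
  moreover have "fps_nth A n > 0" by (simp add: A_def)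
  ultimately show ?case by linarith
qed

section \<open>Positive Hessenberg recurrences\<close>

text \<open>Rotate by the unit \<open>u\<close> that makes the sum positive. Equality then forces
  the real part of every \<open>u * c i\<close> to equal its modulus, and the positive term
  \<open>c k\<close> shows \<open>u = 1\<close>.\<close>

lemma norm_sum_eq_imp_nonneg:
  fixes c :: "'i \<Rightarrow> complex"
  assumes fin: "finite A" and k: "k \<in> A" and ck: "c k = of_real (cmod (c k))" "c k \<noteq> 0"
    and eq: "cmod (\<Sum>i\<in>A. c i) = (\<Sum>i\<in>A. cmod (c i))" and i: "i \<in> A"
  shows "c i = of_real (cmod (c i))"
proof -
  define S where "S = (\<Sum>i\<in>A. c i)"
  have "cmod (c k) \<le> (\<Sum>i\<in>A. cmod (c i))"
    using fin k by (intro member_le_sum) auto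
  then have S0: "cmod S > 0" using ck(2) eq by (simp add: S_def order.strict_trans2[of 0 "cmod (c k)"])
  define u where "u = cnj S / of_real (cmod S)"
  have nu: "cmod u = 1" using S0 by (simp add: u_def norm_divide)
  have "u * S = of_real (cmod S)"
    using S0 by (simp add: u_def complex_norm_square[symmetric] power2_eq_square mult.commute[of "cnj S"])
  then have "Re (\<Sum>i\<in>A. u * c i) = (\<Sum>i\<in>A. cmod (c i))"
    using eq by (simp only: S_def flip: sum_distrib_left) simp
  then have "(\<Sum>i\<in>A. Re (u * c i)) = (\<Sum>i\<in>A. cmod (c i))"
    by (simp only: Re_sum)
  moreover have le: "Re (u * c i) \<le> cmod (c i)" for i
    using complex_Re_le_cmod[of "u * c i"] nu by (simp add: norm_mult)
  ultimately have Re_eq: "Re (u * c i) = cmod (c i)" if "i \<in> A" for i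
    using sum_mono_inv[of "\<lambda>i. Re (u * c i)" A "\<lambda>i. cmod (c i)"] that fin by blast
  have real: "z = of_real (cmod z)" if "Re z = cmod z" for z
    using that cmod_power2[of z] by (simp add: complex_eq_iff)
  have uc: "u * c i = of_real (cmod (c i))" if "i \<in> A" for i
    using real[of "u * c i"] Re_eq[OF that] nu by (simp add: norm_mult)
  have "u = 1"
    using uc[OF k] ck by (metis mult_cancel_right1)
  then show ?thesis using uc[OF i] by simp
qed

lemma poly_pderiv_sum: "poly (pderiv (\<Sum>i\<in>A. f i)) z = (\<Sum>i\<in>A. poly (pderiv (f i)) z)"
  by (induction A rule: infinite_finite_induct) (auto simp: pderiv_add)

text \<open>If \<open>P (Suc n)\<close> vanishes at \<open>z\<close>, then the values of
  \<open>P 0, ..., P n\<close> at \<open>z\<close> form an eigenvector for \<open>z\<close> of the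
  matrix with superdiagonal \<open>a\<close> and lower triangle \<open>b\<close>.\<close>

locale hessenberg =
  fixes a :: "nat \<Rightarrow> real" and b :: "nat \<Rightarrow> nat \<Rightarrow> real" and P :: "nat \<Rightarrow> complex poly"
  assumes a_pos: "a n > 0" and b_pos: "m \<le> n \<Longrightarrow> b n m > 0"
    and P_0: "P 0 = 1"
    and P_Suc: "[:0, 1:] * P n = Polynomial.smult (of_real (a n)) (P (Suc n)) + (\<Sum>m\<le>n. Polynomial.smult (of_real (b n m)) (P m))"
begin

lemma P_recurrence: "z * poly (P n) z = of_real (a n) * poly (P (Suc n)) z + (\<Sum>m\<le>n. of_real (b n m) * poly (P m) z)"
  using arg_cong[OF P_Suc[of n], of "\<lambda>p. poly p z"] by (simp add: poly_sum)

lemma P_deriv_recurrence: "poly (P n) z + z * poly (pderiv (P n)) z =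
    of_real (a n) * poly (pderiv (P (Suc n))) z + (\<Sum>m\<le>n. of_real (b n m) * poly (pderiv (P m)) z)"
  using arg_cong[OF P_Suc[of n], of "\<lambda>p. poly (pderiv p) z"]
  by (simp add: poly_sum pderiv_mult pderiv_add pderiv_smult poly_pderiv_sum pderiv_pCons)

definition r :: "nat \<Rightarrow> real \<Rightarrow> real" where
  "r n x = Re (poly (P n) (of_real x))"

definition r' :: "nat \<Rightarrow> real \<Rightarrow> real" where
  "r' n x = Re (poly (pderiv (P n)) (of_real x))"

lemma r_0 [simp]: "r 0 x = 1"
  by (simp add: r_def P_0)

lemma r_rec: "x * r n x = a n * r (Suc n) x + (\<Sum>m\<le>n. b n m * r m x)"
  using arg_cong[OF P_recurrence[of "of_real x" n], of Re] by (simp add: r_def)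

lemma r'_rec: "r n x + x * r' n x = a n * r' (Suc n) x + (\<Sum>m\<le>n. b n m * r' m x)"
  using arg_cong[OF P_deriv_recurrence[of n "of_real x"], of Re] by (simp add: r_def r'_def)

lemma poly_P_real: "poly (P n) (of_real x) = of_real (r n x)"
proof (induction n rule: less_induct)
  case (less n)
  show ?case
  proof (cases n)
    case (Suc k)
    have "of_real (a k) * poly (P (Suc k)) (of_real x) = of_real x * poly (P k) (of_real x) - (\<Sum>m\<le>k. of_real (b k m) * poly (P m) (of_real x))"
      using P_recurrence[of "of_real x" k] by simp
    also have "\<dots> = of_real x * of_real (r k x) - (\<Sum>m\<le>k. of_real (b k m) * of_real (r m x))"
      using less Suc by (intro arg_cong2[where f = minus] arg_cong2[where f = "(*)"] sum.cong refl) auto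
    also have "\<dots> = of_real (a k) * of_real (r (Suc k) x)"
      using arg_cong[OF r_rec[of x k], of complex_of_real] by simp
    finally show ?thesis using a_pos[of k] Suc by simp
  qed (simp add: P_0)
qed

lemma r_cont: "continuous_on S (r n)"
  unfolding r_def by (intro continuous_intros)

text \<open>Once \<open>r n x\<close> dominates the earlier values and \<open>x\<close> exceeds the
  row sum \<open>a n + (\<Sum>m\<le>n. b n m)\<close>, the recurrence gives
  \<open>r n x \<le> r (Suc n) x\<close>.\<close>

lemma r_large: "\<exists>X. \<forall>x\<ge>X. \<forall>m\<le>n. 0 < r m x \<and> r m x \<le> r n x"
proof (induction n)
  case (Suc n)
  then obtain X where X: "\<And>x m. x \<ge> X \<Longrightarrow> m \<le> n \<Longrightarrow> 0 < r m x \<and> r m x \<le> r n x" by blast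
  have "r n x \<le> r (Suc n) x" if x: "x \<ge> X" "x \<ge> a n + (\<Sum>m\<le>n. b n m)" for x
  proof -
    have "(\<Sum>m\<le>n. b n m * r m x) \<le> (\<Sum>m\<le>n. b n m * r n x)"
      using X[OF x(1)] b_pos[of _ n] by (intro sum_mono mult_left_mono) (auto intro: less_imp_le)
    moreover have "(a n + (\<Sum>m\<le>n. b n m)) * r n x \<le> x * r n x"
      using x(2) X[OF x(1), of n] by (intro mult_right_mono) auto
    ultimately have "a n * r n x \<le> a n * r (Suc n) x"
      using r_rec[of x n] by (simp add: algebra_simps sum_distrib_left)
    then show ?thesis using a_pos[of n] by simp
  qed
  note mono = this
  have "0 < r m x \<and> r m x \<le> r (Suc n) x" if "x \<ge> max X (a n + (\<Sum>m\<le>n. b n m))" "m \<le> Suc n" for x m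
    using mono[of x] X[of x m] X[of x n] that by (cases "m = Suc n") auto
  then show ?case by blast
qed (auto intro: exI[of _ 0])

lemma finite_r_roots:
  assumes "r n x0 \<noteq> 0"
  shows "finite {x. r n x = 0}"
proof -
  have "P n \<noteq> 0" using assms by (auto simp: r_def)
  then have "finite {z. poly (P n) z = 0}" by (rule poly_roots_finite)
  moreover have "of_real ` {x. r n x = 0} \<subseteq> {z. poly (P n) z = 0}"
    by (auto simp: poly_P_real)
  ultimately show ?thesis
    by (meson finite_subset finite_imageD inj_of_real inj_on_subset subset_UNIV)
qed

text \<open>Induction on \<open>n\<close>: at the largest root of one polynomial the recurrence
  makes the next one negative, so the next has a root further right. At that root all earlier values
  are positive and form the Perron eigenvector.\<close>

lemma largest_root:
  "\<exists>\<rho>>0. r (Suc n) \<rho> = 0 \<and> (\<forall>x>\<rho>. r (Suc n) x > 0) \<and> (\<forall>x\<ge>\<rho>. \<forall>m\<le>n. r m x > 0)"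
proof (induction n)
  case 0
  have r1: "r (Suc 0) x = (x - b 0 0) / a 0" for x
    using r_rec[of x 0] a_pos[of 0] by (simp add: field_simps)
  show ?case
    using b_pos[of 0 0] a_pos[of 0] by (intro exI[of _ "b 0 0"]) (auto simp: r1)
next
  case (Suc n)
  then obtain \<rho> where \<rho>: "\<rho> > 0" "r (Suc n) \<rho> = 0" "\<And>x. x > \<rho> \<Longrightarrow> r (Suc n) x > 0"
    "\<And>x m. x \<ge> \<rho> \<Longrightarrow> m \<le> n \<Longrightarrow> r m x > 0" by blast
  let ?f = "r (Suc (Suc n))"
  have "(\<Sum>m\<le>Suc n. b (Suc n) m * r m \<rho>) = (\<Sum>m\<le>n. b (Suc n) m * r m \<rho>)"
    by (simp add: \<rho>)
  moreover have "(\<Sum>m\<le>n. b (Suc n) m * r m \<rho>) > 0"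
    using \<rho>(4)[of \<rho>] b_pos[of _ "Suc n"] by (intro sum_pos mult_pos_pos) auto
  ultimately have "a (Suc n) * ?f \<rho> < 0"
    using r_rec[of \<rho> "Suc n"] \<rho>(2) by simp
  then have neg: "?f \<rho> < 0" using a_pos[of "Suc n"] by (simp add: mult_less_0_iff)
  obtain X where X: "\<And>x. x \<ge> X \<Longrightarrow> ?f x > 0" using r_large[of "Suc (Suc n)"] by blast
  have IVT: "\<exists>y\<ge>x. ?f y = 0" if "?f x \<le> 0" for x
    using IVT'[of ?f x 0 "max x X"] X[of "max x X"] that r_cont by (auto simp: less_imp_le)
  let ?Z = "{x. ?f x = 0 \<and> x \<ge> \<rho>}"
  have fin: "finite ?Z"
    by (rule finite_subset[OF _ finite_r_roots[of "Suc (Suc n)" \<rho>]]) (use neg in auto)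
  have ne: "?Z \<noteq> {}" using IVT[of \<rho>] neg by auto
  define \<rho>' where "\<rho>' = Max ?Z"
  have \<rho>': "?f \<rho>' = 0" "\<rho>' \<ge> \<rho>" using Max_in[OF fin ne] by (auto simp: \<rho>'_def)
  then have gt: "\<rho>' > \<rho>" using neg by (cases "\<rho>' = \<rho>") auto
  have "?f x > 0" if "x > \<rho>'" for x
  proof (rule ccontr)
    assume "\<not> ?thesis"
    then obtain y where "y \<ge> x" "?f y = 0" using IVT[of x] by auto
    then have "y \<le> \<rho>'" unfolding \<rho>'_def using fin that \<rho>'(2) by (intro Max_ge) auto
    then show False using \<open>y \<ge> x\<close> that by simp
  qed
  moreover have "r m x > 0" if "x \<ge> \<rho>'" "m \<le> Suc n" for x m
    using \<rho>(3)[of x] \<rho>(4)[of x m] gt that by (cases "m = Suc n") auto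
  ultimately show ?case using \<rho>' gt \<rho>(1) by (intro exI[of _ \<rho>']) auto
qed

context
  fixes n :: nat and \<rho> :: real
  assumes root: "r (Suc n) \<rho> = 0" and pos: "\<And>m. m \<le> n \<Longrightarrow> r m \<rho> > 0"
begin

text \<open>\<open>t\<close> is the least multiple of the Perron vector that bounds
  \<open>v\<close>, and \<open>i\<close> is a point of contact; this is the setting for the two
  maximum principle arguments that follow.\<close>

lemma ratio_max:
  fixes v :: "nat \<Rightarrow> real"
  obtains i t where "i \<le> n" "v i = t * r i \<rho>" "\<And>m. m \<le> n \<Longrightarrow> v m \<le> t * r m \<rho>"
proof -
  let ?V = "(\<lambda>m. v m / r m \<rho>) ` {..n}"
  have "Max ?V \<in> ?V" by (rule Max_in) auto
  then obtain i where i_max: "Max ?V = v i / r i \<rho>" and "i \<in> {..n}" by (rule imageE)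
  then have i: "i \<le> n" by simp
  have max: "v m / r m \<rho> \<le> v i / r i \<rho>" if "m \<le> n" for m
    unfolding i_max[symmetric] using that by (intro Max_ge) auto
  show ?thesis
  proof (rule that[OF i, of "v i / r i \<rho>"])
    show "v m \<le> v i / r i \<rho> * r m \<rho>" if "m \<le> n" for m
      using max[OF that] pos[OF that] by (simp add: pos_divide_le_eq)
  qed (use pos[OF i] in auto)
qed

text \<open>Differentiating the recurrence at a double root would give a vector \<open>v\<close> with \<open>M v = \<rho> v + w\<close>,
  where \<open>M\<close> is the Hessenberg matrix and \<open>w > 0\<close> its eigenvector; this fails where \<open>v / w\<close> is maximal.\<close>

lemma simple_root: "r' (Suc n) \<rho> \<noteq> 0"
proof
  assume z: "r' (Suc n) \<rho> = 0"
  obtain i t where i: "i \<le> n" "r' i \<rho> = t * r i \<rho>" and t: "\<And>m. m \<le> n \<Longrightarrow> r' m \<rho> \<le> t * r m \<rho>"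
    using ratio_max[of "\<lambda>m. r' m \<rho>"] by blast
  have t': "r' m \<rho> \<le> t * r m \<rho>" if "m \<le> Suc n" for m
    using t[of m] z root that by (cases "m = Suc n") auto
  have "r i \<rho> + \<rho> * r' i \<rho> = a i * r' (Suc i) \<rho> + (\<Sum>m\<le>i. b i m * r' m \<rho>)"
    by (rule r'_rec)
  also have "\<dots> \<le> a i * (t * r (Suc i) \<rho>) + (\<Sum>m\<le>i. b i m * (t * r m \<rho>))"
    using a_pos[of i] b_pos[of _ i] t' i(1)
    by (intro add_mono sum_mono mult_left_mono) (auto intro: less_imp_le)
  also have "\<dots> = t * (a i * r (Suc i) \<rho> + (\<Sum>m\<le>i. b i m * r m \<rho>))"
    by (simp add: algebra_simps sum_distrib_left)
  also have "\<dots> = \<rho> * r' i \<rho>"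
    by (simp add: r_rec[symmetric] i)
  finally show False using pos[OF i(1)] by simp
qed

text \<open>If \<open>cmod z \<ge> \<rho>\<close>, the moduli of the eigenvector for
  \<open>z\<close> touch a multiple of the Perron vector. Equality in the recurrence spreads contact
  to all indices and aligns all phases, so the two vectors agree and \<open>z\<close> equals
  \<open>\<rho>\<close>.\<close>

lemma dominant_root:
  assumes z: "poly (P (Suc n)) z = 0" and ne: "z \<noteq> of_real \<rho>" and \<rho>: "\<rho> > 0"
  shows "cmod z < \<rho>"
proof (rule ccontr)
  assume "\<not> cmod z < \<rho>"
  then have ge: "cmod z \<ge> \<rho>" by simp
  define v where "v m = poly (P m) z" for m
  have v0: "v 0 = 1" by (simp add: v_def P_0)
  have rec: "z * v m = of_real (a m) * v (Suc m) + (\<Sum>k\<le>m. of_real (b m k) * v k)" for m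
    unfolding v_def by (rule P_recurrence)
  obtain i t where i: "i \<le> n" "cmod (v i) = t * r i \<rho>" and t: "\<And>m. m \<le> n \<Longrightarrow> cmod (v m) \<le> t * r m \<rho>"
    using ratio_max[of "\<lambda>m. cmod (v m)"] by blast
  have t': "cmod (v m) \<le> t * r m \<rho>" if "m \<le> Suc n" for m
    using t[of m] z root that by (cases "m = Suc n") (auto simp: v_def)
  \<comment> \<open>Contact at \<open>j\<close> squeezes row \<open>j\<close> of the recurrence into
    equalities: contact holds at \<open>Suc j\<close> and at every \<open>m \<le> j\<close>, and the
    triangle inequality is sharp.\<close>
  have attain: "a j * cmod (v (Suc j)) = a j * (t * r (Suc j) \<rho>) \<and> (\<forall>m\<le>j. cmod (v m) = t * r m \<rho>) \<and>
      cmod (of_real (a j) * v (Suc j) + (\<Sum>k\<le>j. of_real (b j k) * v k)) = a j * cmod (v (Suc j)) + (\<Sum>k\<le>j. b j k * cmod (v k))"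
    if j: "j \<le> n" "cmod (v j) = t * r j \<rho>" for j
  proof -
    let ?L = "of_real (a j) * v (Suc j) + (\<Sum>k\<le>j. of_real (b j k) * v k)"
    have tri: "cmod ?L \<le> a j * cmod (v (Suc j)) + (\<Sum>k\<le>j. b j k * cmod (v k))"
    proof -
      have "cmod (\<Sum>k\<le>j. of_real (b j k) * v k) \<le> (\<Sum>k\<le>j. b j k * cmod (v k))"
        using b_pos[of _ j] by (intro sum_norm_le) (auto simp: norm_mult less_imp_le)
      moreover have "cmod (of_real (a j) * v (Suc j)) = a j * cmod (v (Suc j))"
        using a_pos[of j] by (simp add: norm_mult)
      ultimately show ?thesis
        using norm_triangle_ineq[of "of_real (a j) * v (Suc j)" "\<Sum>k\<le>j. of_real (b j k) * v k"] by linarith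
    qed
    have A: "a j * cmod (v (Suc j)) \<le> a j * (t * r (Suc j) \<rho>)"
      using a_pos[of j] t'[of "Suc j"] j by simp
    have B: "b j k * cmod (v k) \<le> b j k * (t * r k \<rho>)" if "k \<le> j" for k
      using b_pos[OF that] t'[of k] j that by simp
    have "a j * (t * r (Suc j) \<rho>) + (\<Sum>k\<le>j. b j k * (t * r k \<rho>)) = t * (\<rho> * r j \<rho>)"
      unfolding r_rec by (simp add: algebra_simps sum_distrib_left)
    also have "\<dots> = \<rho> * cmod (v j)" using j by simp
    also have "\<dots> \<le> cmod z * cmod (v j)" using ge by (intro mult_right_mono) auto
    also have "\<dots> = cmod ?L" unfolding rec[symmetric] by (simp add: norm_mult)
    finally have chain: "a j * (t * r (Suc j) \<rho>) + (\<Sum>k\<le>j. b j k * (t * r k \<rho>)) \<le> cmod ?L" .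
    have sumB: "(\<Sum>k\<le>j. b j k * cmod (v k)) \<le> (\<Sum>k\<le>j. b j k * (t * r k \<rho>))"
      by (intro sum_mono B) auto
    have eqA: "a j * cmod (v (Suc j)) = a j * (t * r (Suc j) \<rho>)"
      and eqB: "(\<Sum>k\<le>j. b j k * cmod (v k)) = (\<Sum>k\<le>j. b j k * (t * r k \<rho>))"
      and eqL: "cmod ?L = a j * cmod (v (Suc j)) + (\<Sum>k\<le>j. b j k * cmod (v k))"
      using chain tri A sumB by linarith+
    have eq_terms: "b j k * cmod (v k) = b j k * (t * r k \<rho>)" if "k \<le> j" for k
      by (rule sum_mono_inv[OF eqB _ _ finite_atMost]) (simp_all only: atMost_iff B that)
    have att: "cmod (v k) = t * r k \<rho>" if "k \<le> j" for k
      using mult_left_cancel[of "b j k"] eq_terms[OF that] b_pos[OF that] by simp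
    show ?thesis by (intro conjI allI impI eqA eqL att)
  qed
  \<comment> \<open>Contact climbs along the superdiagonal up to \<open>n\<close>; the last row, all
    of whose entries are positive, then gives contact everywhere.\<close>
  have "cmod (v j) = t * r j \<rho>" if "i \<le> j" "j \<le> n" for j
    using that
  proof (induction j rule: dec_induct)
    case (step j)
    then have "j \<le> n" by simp
    from attain[OF this step.IH[OF this]] have "a j * cmod (v (Suc j)) = a j * (t * r (Suc j) \<rho>)"
      by (rule conjunct1)
    then show ?case using a_pos[of j] by simp
  qed (use i in auto)
  then have last: "cmod (v n) = t * r n \<rho>" using i by blast
  note attain_n = attain[OF order_refl last]
  have "cmod (v 0) = t * r 0 \<rho>" by (rule attain_n[THEN conjunct2, THEN conjunct1, rule_format]) simp
  then have "t = 1" by (simp add: v0)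
  then have cm: "cmod (v m) = r m \<rho>" if "m \<le> n" for m
    using attain_n[THEN conjunct2, THEN conjunct1, rule_format, OF that] by simp
  \<comment> \<open>In the last row only the terms with coefficients \<open>b n k\<close> remain;
    they share one phase, which \<open>v 0 = 1\<close> makes positive.\<close>
  have "v (Suc n) = 0" using z by (simp add: v_def)
  then have "cmod (\<Sum>k\<le>n. of_real (b n k) * v k) = (\<Sum>k\<le>n. cmod (of_real (b n k) * v k))"
    using attain_n[THEN conjunct2, THEN conjunct2] b_pos[of _ n] by (simp add: norm_mult less_imp_le)
  from norm_sum_eq_imp_nonneg[OF _ _ _ _ this, of 0]
  have phase: "of_real (b n m) * v m = of_real (cmod (of_real (b n m) * v m))" if "m \<le> n" for m
    using that b_pos[of 0 n] v0 by (simp add: norm_mult less_imp_le)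
  have vm: "v m = of_real (r m \<rho>)" if "m \<le> n" for m
    using phase[OF that] b_pos[OF that] cm[OF that] by (simp add: norm_mult)
  have v1: "v (Suc 0) = of_real (r (Suc 0) \<rho>)"
    using vm[of "Suc 0"] \<open>v (Suc n) = 0\<close> root by (cases n) auto
  \<comment> \<open>Row 0 of the recurrence recovers the eigenvalue from \<open>v 0\<close> and
    \<open>v (Suc 0)\<close>.\<close>
  have "z = of_real (\<rho> * r 0 \<rho>)"
    unfolding r_rec using rec[of 0] v0 v1 by simp
  then show False using ne by simp
qed

end

theorem Perron_root:
  "\<exists>\<rho>>0. poly (P (Suc n)) (of_real \<rho>) = 0 \<and> poly (pderiv (P (Suc n))) (of_real \<rho>) \<noteq> 0 \<and>
    (\<forall>z. poly (P (Suc n)) z = 0 \<and> z \<noteq> of_real \<rho> \<longrightarrow> cmod z < \<rho>)"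
proof -
  obtain \<rho> where \<rho>: "\<rho> > 0" "r (Suc n) \<rho> = 0" "\<And>m. m \<le> n \<Longrightarrow> r m \<rho> > 0"
    using largest_root[of n] by blast
  show ?thesis
    using \<rho>(1) simple_root[OF \<rho>(2,3)] dominant_root[OF \<rho>(2,3)] \<rho>(2)
    by (intro exI[of _ \<rho>]) (auto simp: poly_P_real r'_def)
qed

end

section \<open>Zeros of the Nekrasov--Okounkov polynomials\<close>

definition NO_shift :: "nat \<Rightarrow> complex poly" where
  "NO_shift n = pcompose (NO n) [:-1, 1:]"

lemma NO_shift_recurrence: "of_nat n * poly (NO_shift n) z = z * (\<Sum>i=1..n. of_nat (sigma i) * poly (NO_shift (n - i)) z)"
  using arg_cong[OF NO_recurrence[of n], of "\<lambda>p. poly p (z - 1)"]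
  by (simp add: NO_shift_def poly_pcompose poly_sum sigma_def left_diff_distrib del: of_nat_sum)

definition NO_alt :: "complex \<Rightarrow> nat \<Rightarrow> complex" where
  "NO_alt x n = (- 1) ^ n * poly (NO_shift n) (- x)"

text \<open>The logarithmic derivative of the generating function is \<open>x\<close> times a power series in \<open>q\<close>
  not involving \<open>x\<close>; inverting that series isolates multiplication by \<open>x\<close>.\<close>

lemma NO_alt_recurrence:
  "x * NO_alt x n = (\<Sum>j\<le>n. of_real (fps_nth (inverse sigma_fps) j) * of_nat (Suc n - j) * NO_alt x (Suc n - j))"
proof -
  define U :: "complex fps" where "U = Abs_fps (\<lambda>k. of_real (fps_nth sigma_fps k))"
  define V :: "complex fps" where "V = Abs_fps (\<lambda>k. of_real (fps_nth (inverse sigma_fps) k))"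
  define G where "G = Abs_fps (NO_alt x)"
  have "fps_nth sigma_fps 0 \<noteq> 0" by (simp add: sigma_fps_def sigma_1)
  then have inv: "inverse sigma_fps * sigma_fps = 1" by (rule inverse_mult_eq_1)
  have VU: "V * U = 1"
  proof (rule fps_ext)
    fix k
    have "fps_nth (V * U) k = of_real (fps_nth (inverse sigma_fps * sigma_fps) k)"
      by (simp add: U_def V_def fps_mult_nth)
    then show "fps_nth (V * U) k = fps_nth 1 k" by (simp add: inv)
  qed
  have dG: "fps_deriv G = fps_const x * (U * G)"
  proof (rule fps_ext)
    fix k
    have "fps_nth (fps_deriv G) k = (- 1) ^ Suc k * (of_nat (Suc k) * poly (NO_shift (Suc k)) (- x))"
      by (simp add: G_def NO_alt_def algebra_simps)
    also have "\<dots> = (- 1) ^ k * x * (\<Sum>i=1..Suc k. of_nat (sigma i) * poly (NO_shift (Suc k - i)) (- x))"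
      unfolding NO_shift_recurrence by simp
    also have "(\<Sum>i=1..Suc k. of_nat (sigma i) * poly (NO_shift (Suc k - i)) (- x)) =
        (\<Sum>i\<le>k. of_nat (sigma (Suc i)) * poly (NO_shift (k - i)) (- x))"
      unfolding One_nat_def sum.atLeast1_atMost_eq lessThan_Suc_atMost by simp
    also have "(- 1) ^ k * x * \<dots> = x * (\<Sum>i\<le>k. (- 1) ^ i * of_nat (sigma (Suc i)) * ((- 1) ^ (k - i) * poly (NO_shift (k - i)) (- x)))"
    proof -
      have "(- 1 :: complex) ^ k * c = (- 1) ^ i * ((- 1) ^ (k - i) * c)" if "i \<in> {..k}" for i c
        using that by (simp flip: power_add mult.assoc)
      then show ?thesis
        by (simp only: mult.assoc mult.left_commute[of _ x] sum_distrib_left mult.left_commute[of "of_nat _"] cong: sum.cong)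
    qed
    also have "\<dots> = fps_nth (fps_const x * (U * G)) k"
      unfolding fps_mult_left_const_nth by (simp add: U_def G_def NO_alt_def sigma_fps_def fps_mult_nth atLeast0AtMost)
    finally show "fps_nth (fps_deriv G) k = fps_nth (fps_const x * (U * G)) k" .
  qed
  have "V * fps_deriv G = fps_const x * ((V * U) * G)"
    unfolding dG by (simp only: mult_ac)
  then have "V * fps_deriv G = fps_const x * G"
    by (simp only: VU mult_1_left)
  then have "fps_nth (V * fps_deriv G) n = x * fps_nth G n"
    by (simp only: fps_mult_left_const_nth)
  then show ?thesis
    by (simp add: V_def G_def fps_mult_nth atLeast0AtMost Suc_diff_le mult.assoc)
qed

text \<open>The factor \<open>z\<close> split off from \<open>NO_shift (Suc n)\<close>, reflected and with sign normalised, so that the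
  coefficients of the recurrence become positive.\<close>

definition NO_reduced :: "nat \<Rightarrow> complex poly" where
  "NO_reduced n = Polynomial.smult ((- 1) ^ n / of_nat (Suc n)) (\<Sum>i=1..Suc n. Polynomial.smult (of_nat (sigma i)) (pcompose (NO_shift (Suc n - i)) [:0, -1:]))"

lemma poly_NO_shift_Suc: "poly (NO_shift (Suc n)) z = (- 1) ^ n * z * poly (NO_reduced n) (- z)"
proof -
  have "poly (NO_reduced n) (- z) = (- 1) ^ n / of_nat (Suc n) * (\<Sum>i=1..Suc n. of_nat (sigma i) * poly (NO_shift (Suc n - i)) z)"
    by (simp add: NO_reduced_def poly_sum poly_pcompose)
  then have "(- 1) ^ n * z * poly (NO_reduced n) (- z) = ((- 1) ^ n * (- 1) ^ n) * (z * (\<Sum>i=1..Suc n. of_nat (sigma i) * poly (NO_shift (Suc n - i)) z) / of_nat (Suc n))"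
    by (simp add: mult_ac del: of_nat_Suc)
  also have "\<dots> = poly (NO_shift (Suc n)) z"
    unfolding NO_shift_recurrence[symmetric] by (simp add: power_mult_distrib[symmetric] del: of_nat_Suc)
  finally show ?thesis by simp
qed

lemma NO_alt_Suc: "NO_alt x (Suc n) = x * poly (NO_reduced n) x"
  by (simp add: NO_alt_def poly_NO_shift_Suc power_mult_distrib[symmetric])

text \<open>Apply \<open>NO_alt_recurrence\<close> at \<open>Suc n\<close> and divide by
  \<open>x\<close>. The term \<open>j = 0\<close> has series coefficient 1 and yields the
  superdiagonal entry \<open>n + 2\<close>; the other terms, with \<open>j = Suc n - m\<close>,
  yield the positive lower triangle.\<close>

interpretation NO: hessenberg "\<lambda>n. real n + 2" "\<lambda>n m. fps_nth (inverse sigma_fps) (Suc n - m) * real (Suc m)" NO_reduced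
proof
  show "NO_reduced 0 = 1"
    by (simp add: NO_reduced_def NO_shift_def NO_0 sigma_1 one_pCons[symmetric] pcompose_1)
next
  fix n
  let ?d = "\<lambda>j. fps_nth (inverse sigma_fps) j"
  let ?r = "Polynomial.smult (of_real (real n + 2)) (NO_reduced (Suc n)) + (\<Sum>m\<le>n. Polynomial.smult (of_real (?d (Suc n - m) * real (Suc m))) (NO_reduced m))"
  \<comment> \<open>The extra factor \<open>x\<close>, cancelled at the end, is the one that
    \<open>NO_alt_Suc\<close> splits off.\<close>
  have "poly ([:0, 1:] * ([:0, 1:] * NO_reduced n)) x = poly ([:0, 1:] * ?r) x" for x
  proof -
    have "x * NO_alt x (Suc n) = (\<Sum>j\<le>Suc n. of_real (?d j) * of_nat (Suc (Suc n) - j) * NO_alt x (Suc (Suc n) - j))"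
      by (rule NO_alt_recurrence)
    also have "\<dots> = (\<Sum>m\<le>Suc n. of_real (?d (Suc n - m)) * of_nat (Suc m) * NO_alt x (Suc m))"
      by (rule sum.reindex_bij_witness[of _ "\<lambda>m. Suc n - m" "\<lambda>j. Suc n - j"]) (auto simp: Suc_diff_le)
    also have "\<dots> = x * poly ?r x"
    proof -
      have "?d 0 = 1" by (simp add: sigma_fps_def sigma_1)
      then show ?thesis
        by (simp add: NO_alt_Suc poly_sum sum_distrib_left algebra_simps)
    qed
    finally show ?thesis by (simp add: NO_alt_Suc)
  qed
  then have "[:0, 1:] * ([:0, 1:] * NO_reduced n) = [:0, 1:] * ?r"
    by (intro poly_eq_poly_eq_iff[THEN iffD1] ext)
  then show "[:0, 1:] * NO_reduced n = ?r"
    by (subst (asm) mult_left_cancel) simp_all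
qed (auto intro!: mult_pos_pos inverse_sigma_fps_pos)

lemma NO_Suc: "NO (Suc n) = Polynomial.smult ((- 1) ^ n) ([:1, 1:] * pcompose (NO_reduced n) [:-1, -1:])"
proof -
  have "poly (NO (Suc n)) z = poly (Polynomial.smult ((- 1) ^ n) ([:1, 1:] * pcompose (NO_reduced n) [:-1, -1:])) z" for z
    using poly_NO_shift_Suc[of n "z + 1"] by (simp add: NO_shift_def poly_pcompose algebra_simps)
  then show ?thesis by (intro poly_eq_poly_eq_iff[THEN iffD1] ext)
qed

lemma order_eq_1:
  fixes p :: "'a::field_char_0 poly"
  assumes "poly p x = 0" "poly (pderiv p) x \<noteq> 0"
  shows "order x p = 1"
proof -
  have "pderiv p \<noteq> 0" "p \<noteq> 0" using assms(2) by auto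
  then have "order x p = Suc (order x (pderiv p))"
    using assms(1) by (intro order_pderiv) (auto simp: order_root)
  then show ?thesis using assms(2) by (simp add: order_0I)
qed

text \<open>The zeros of \<open>NO n\<close> are -1 and the points \<open>- 1 - y\<close> for zeros
  \<open>y\<close> of the reduced polynomial, so the Perron root decides which is largest.\<close>

theorem corollary2p2:
  fixes n :: nat
  assumes "n \<ge> 1"
  shows "\<exists>\<alpha>::complex.
           poly (NO n) \<alpha> = 0 \<and>
           (\<forall>\<beta>. poly (NO n) \<beta> = 0 \<and> \<beta> \<noteq> \<alpha> \<longrightarrow> cmod \<beta> < cmod \<alpha>) \<and>
           \<alpha> \<in> \<real> \<and> Re \<alpha> < 0 \<and> order \<alpha> (NO n) = 1"
proof -
  obtain k where n: "n = Suc k" using assms by (cases n) auto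
  have poly_NO: "poly (NO n) z = (- 1) ^ k * (z + 1) * poly (NO_reduced k) (- (z + 1))" for z
    by (simp add: n NO_Suc poly_pcompose algebra_simps)
  have deriv_NO: "poly (pderiv (NO n)) z =
      (- 1) ^ k * (poly (NO_reduced k) (- (z + 1)) - (z + 1) * poly (pderiv (NO_reduced k)) (- (z + 1)))" for z
    by (simp only: n NO_Suc pderiv_smult pderiv_mult pderiv_pcompose)
       (simp add: poly_pcompose pderiv_pCons algebra_simps)
  show ?thesis
  proof (cases k)
    \<comment> \<open>Here the reduced polynomial is constant and -1 is the only zero.\<close>
    case 0
    have "NO_reduced k = 1" using 0 NO.P_0 by simp
    then show ?thesis
      by (intro exI[of _ "-1"] conjI allI impI order_eq_1) (auto simp: poly_NO deriv_NO eq_neg_iff_add_eq_0)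
  next
    case (Suc m)
    obtain \<rho> where \<rho>: "\<rho> > 0" "poly (NO_reduced k) (of_real \<rho>) = 0" "poly (pderiv (NO_reduced k)) (of_real \<rho>) \<noteq> 0"
      and dom: "\<And>z. poly (NO_reduced k) z = 0 \<Longrightarrow> z \<noteq> of_real \<rho> \<Longrightarrow> cmod z < \<rho>"
      using NO.Perron_root[of m] Suc by blast
    \<comment> \<open>The image of the Perron root under \<open>y \<mapsto> - 1 - y\<close>.\<close>
    let ?\<alpha> = "of_real (- 1 - \<rho>) :: complex"
    have shift: "- (?\<alpha> + 1) = of_real \<rho>" by simp
    have cmod_\<alpha>: "cmod ?\<alpha> = 1 + \<rho>" unfolding norm_of_real using \<rho>(1) by simp
    have "cmod \<beta> < cmod ?\<alpha>" if "poly (NO n) \<beta> = 0" "\<beta> \<noteq> ?\<alpha>" for \<beta>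
    proof (cases "\<beta> + 1 = 0")
      case True
      then have "\<beta> = - 1" by (simp add: eq_neg_iff_add_eq_0)
      then show ?thesis using cmod_\<alpha> \<rho>(1) by simp
    next
      case False
      then have "poly (NO_reduced k) (- (\<beta> + 1)) = 0" using that(1) by (simp add: poly_NO)
      moreover have "- (\<beta> + 1) \<noteq> of_real \<rho>"
        using that(2) by (auto simp: algebra_simps)
      ultimately have "cmod (- (\<beta> + 1)) < \<rho>" by (rule dom)
      then have "cmod (\<beta> + 1) < \<rho>" by (simp only: norm_minus_cancel)
      then show ?thesis using norm_triangle_ineq4[of "\<beta> + 1" 1] cmod_\<alpha> by simp
    qed
    moreover have root: "poly (NO n) ?\<alpha> = 0"
      unfolding poly_NO shift using \<rho>(2) by simp
    moreover have "order ?\<alpha> (NO n) = 1"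
      using root by (rule order_eq_1) (unfold deriv_NO shift, use \<rho> in simp)
    moreover have "?\<alpha> \<in> \<real>" by (rule Reals_of_real)
    moreover have "Re ?\<alpha> < 0" unfolding Re_complex_of_real using \<rho>(1) by simp
    ultimately show ?thesis by blast
  qed
qed

end
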